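(* Let $\diamondsuit\in\{\varnothing,\square,\mathrm{h},\mathrm{v}\}$, let $n\ge 1$ and let $\nu=(\nu_1,\dots,\nu_n)\in\mathbb{Z}^n$. Then $$B^{\diamondsuit}_{\nu_1}B^{\diamondsuit}_{\nu_2}\cdots B^{\diamondsuit}_{\nu_n}\,1 \;=\; B^{\diamondsuit}_{\nu}\,1\;=\;s^{\diamondsuit}_\nu[X].$$
   Context: $\Lambda$ is the ring of symmetric functions in $X=x_1+x_2+\cdots$ (rational coefficients, extended by auxiliary indeterminates as needed), with the scalar product $\langle\cdot,\cdot\rangle$ for which Schur functions are orthonormal. Plethystic notation: $P[A]$ is obtained from $P\in\Lambda$ by expressing $P$ in power sums and replacing $p_k$ by $p_k[A]$, where $p_k[A]$ raises every indeterminate in $A$ to the $k$-th power and $p_k[A-B]=p_k[A]-p_k[B]$; $\Omega[A]=\exp(\sum_{k\ge1}p_k[A]/k)$, so that $\Omega[A-B]=\prod_{b\in B}(1-b)/\prod_{a\in A}(1-a)$ when $A,B$ are sums of monomials. $P^\perp$ is the operator on $\Lambda$ adjoint to multiplication by $P$ (skewing is always in the $X$ variables and extends to infinite sums of homogeneous pieces); in particular $\Omega[XA]^\perp P[X]=P[X+A]$. The four symbols: $\varnothing$; $\square$ (single cell); $\mathrm{h}$ (horizontal domino); $\mathrm{v}$ (vertical domino). Put $f_\varnothing=0$, $f_\square=s_1+s_{(1^2)}$, $f_{\mathrm{h}}=s_2$, $f_{\mathrm{v}}=s_{(1^2)}$, so that $\Omega[-f_{\mathrm v}[X]]=\prod_{i<j}(1-x_ix_j)$,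 $\Omega[-f_{\mathrm h}[X]]=\prod_{i\le j}(1-x_ix_j)$, $\Omega[-f_\square[X]]=\prod_i(1-x_i)\prod_{i<j}(1-x_ix_j)$. For $\nu\in\mathbb{Z}^n$ let $s_\nu=\det(s_{\nu_i-i+j})_{1\le i,j\le n}$, where $s_r$ is the complete homogeneous symmetric function for $r\ge0$ and $s_r=0$ for $r<0$. Put $s^\diamondsuit_\nu=\Omega[-f_\diamondsuit]^\perp s_\nu$. Bernstein's operators $B_r\in\mathrm{End}(\Lambda)$ ($r\in\mathbb{Z}$) are defined by $\sum_{r\in\mathbb{Z}}B_rz^r=\Omega[zX]\,\Omega[-z^{-1}X]^\perp$ (skew, then multiply). For $\nu\in\mathbb{Z}^n$, $B_\nu=B_{\nu_1}\circ\cdots\circ B_{\nu_n}$ and $$B^\diamondsuit_\nu=\Omega[-f_\diamondsuit]^\perp\circ B_\nu\circ\Omega[f_\diamondsuit]^\perp .$$ *)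

theory Defs
  imports
    "HOL-Library.Multiset"
    "HOL-Library.Groups_Big_Fun"
    "Jordan_Normal_Form.Determinant"
begin

section \<open>Formal power series in arbitrarily many indeterminates\<close>

text \<open>Monomials are finite multisets of indeterminates. A series is an arbitrary family of rational
  coefficients, so it may have unbounded degree and involve infinitely many indeterminates.\<close>

typedef 'v series = "UNIV :: ('v multiset \<Rightarrow> rat) set"
  morphisms scoeff Series
  by simp

lemma scoeff_Series [simp]: "scoeff (Series f) = f"
  by (simp add: Series_inverse)

lemma series_eqI: "(\<And>M. scoeff F M = scoeff G M) \<Longrightarrow> F = G"
  by (metis ext scoeff_inject)

lemma finite_submultisets: "finite {A. A \<subseteq># M}"
proof (induction M)
  case (add x M)
  have "{A. A \<subseteq># add_mset x M} \<subseteq> {A. A \<subseteq># M} \<union> add_mset x ` {A. A \<subseteq># M}"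
  proof
    fix A assume A: "A \<in> {A. A \<subseteq># add_mset x M}"
    show "A \<in> {A. A \<subseteq># M} \<union> add_mset x ` {A. A \<subseteq># M}"
    proof (cases "x \<in># A")
      case True
      then obtain B where "A = add_mset x B"
        by (meson mset_add)
      with A show ?thesis by auto
    next
      case False
      then have "A \<subseteq># M"
        using A by (metis mem_Collect_eq add_mset_remove_trivial diff_single_trivial
          subset_eq_diff_conv add_mset_add_single)
      then show ?thesis by simp
    qed
  qed
  with add show ?case
    by (meson finite_UnI finite_imageI finite_subset)
qed simp

instantiation series :: (type) comm_ring_1
begin

definition "0 = Series (\<lambda>M. 0)"
definition "1 = Series (\<lambda>M. if M = {#} then 1 else 0)"
definition "F + G = Series (\<lambda>M. scoeff F M + scoeff G M)"
definition "F - G = Series (\<lambda>M. scoeff F M - scoeff G M)"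
definition "- F = Series (\<lambda>M. - scoeff F M)"
definition "F * G = Series (\<lambda>M. \<Sum>A | A \<subseteq># M. scoeff F A * scoeff G (M - A))"

instance
proof
  fix F G H :: "'a series"
  show "F + G + H = F + (G + H)"
    by (simp add: plus_series_def add.assoc)
  show "F + G = G + F"
    by (simp add: plus_series_def add.commute)
  show "0 + F = F"
    by (rule series_eqI) (simp add: plus_series_def zero_series_def)
  show "- F + F = 0"
    by (simp add: plus_series_def zero_series_def uminus_series_def)
  show "F - G = F + - G"
    by (simp add: plus_series_def minus_series_def uminus_series_def)
  show "(0::'a series) \<noteq> 1"
  proof
    assume "(0::'a series) = 1"
    then have "scoeff (0::'a series) {#} = scoeff 1 {#}" by simp
    then show False by (simp add: zero_series_def one_series_def)
  qed
  show comm: "F * G = G * F"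
  proof (rule series_eqI)
    fix M
    have "(\<Sum>A | A \<subseteq># M. scoeff F A * scoeff G (M - A)) =
        (\<Sum>A | A \<subseteq># M. scoeff G A * scoeff F (M - A))"
      by (rule sum.reindex_bij_witness[of _ "\<lambda>A. M - A" "\<lambda>A. M - A"])
        (auto simp: subset_mset.diff_diff_right mult.commute)
    then show "scoeff (F * G) M = scoeff (G * F) M"
      by (simp add: times_series_def)
  qed
  show "1 * F = F"
  proof (rule series_eqI)
    fix M
    have "(\<Sum>A | A \<subseteq># M. (if A = {#} then 1 else 0) * scoeff F (M - A)) =
        (\<Sum>A | A \<subseteq># M. if A = {#} then scoeff F M else 0)"
      by (rule sum.cong) auto
    also have "\<dots> = scoeff F M"
      by (subst sum.delta[OF finite_submultisets]) simp
    finally show "scoeff (1 * F) M = scoeff F M"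
      by (simp add: times_series_def one_series_def)
  qed
  show "(F + G) * H = F * H + G * H"
    by (rule series_eqI) (simp add: times_series_def plus_series_def distrib_right sum.distrib)
  show "F * G * H = F * (G * H)"
  proof (rule series_eqI)
    fix M
    have "scoeff (F * G * H) M = (\<Sum>A | A \<subseteq># M. \<Sum>B | B \<subseteq># A.
        scoeff F B * scoeff G (A - B) * scoeff H (M - A))"
      by (simp add: times_series_def sum_distrib_right)
    also have "\<dots> = (\<Sum>(A, B)\<in>(SIGMA A:{A. A \<subseteq># M}. {B. B \<subseteq># A}).
        scoeff F B * scoeff G (A - B) * scoeff H (M - A))"
      by (subst sum.Sigma) (auto simp: finite_submultisets)
    also have "\<dots> = (\<Sum>(B, C)\<in>(SIGMA B:{B. B \<subseteq># M}. {C. C \<subseteq># M - B}).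
        scoeff F B * (scoeff G C * scoeff H (M - B - C)))"
      by (rule sum.reindex_bij_witness[of _ "\<lambda>(B, C). (B + C, B)" "\<lambda>(A, B). (B, A - B)"])
        (auto simp: mult.assoc subset_mset.le_diff_conv2 add.commute
          intro: subset_mset.order_trans)
    also have "\<dots> = scoeff (F * (G * H)) M"
      by (subst sum.Sigma[symmetric])
        (auto simp: finite_submultisets times_series_def sum_distrib_left)
    finally show "scoeff (F * G * H) M = scoeff (F * (G * H)) M" .
  qed
qed

end

definition series_scale :: "rat \<Rightarrow> 'v series \<Rightarrow> 'v series" where
  "series_scale c F = Series (\<lambda>M. c * scoeff F M)"

global_interpretation series: vector_space "series_scale :: rat \<Rightarrow> 'v series \<Rightarrow> 'v series"
  by unfold_locales
    (auto intro!: series_eqI simp: series_scale_def plus_series_def algebra_simps)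

text \<open>Sum of a locally finite family: each monomial has a nonzero coefficient in only finitely
  many members.\<close>

definition locally_finite_sum :: "(nat \<Rightarrow> 'v series) \<Rightarrow> 'v series" where
  "locally_finite_sum F = Series (\<lambda>M. Sum_any (\<lambda>n. scoeff (F n) M))"

section \<open>Plethystic exponential\<close>

text \<open>\<open>power_plethysm k A\<close> is $p_k[A]$ for $k \ge 1$: each monomial $x^N$ of \<open>A\<close> becomes $x^{kN}$,
  and the rational coefficients are left alone, so that $p_k[-A] = -p_k[A]$.\<close>

definition power_plethysm :: "nat \<Rightarrow> 'v series \<Rightarrow> 'v series" where
  "power_plethysm k A = Series (\<lambda>M. \<Sum>N | repeat_mset k N = M. scoeff A N)"

text \<open>\<open>series_exp\<close> and \<open>Omega\<close> are meant for series with constant term zero; the families summed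
  are then locally finite.\<close>

definition series_exp :: "'v series \<Rightarrow> 'v series" where
  "series_exp F = locally_finite_sum (\<lambda>n. series_scale (1 / fact n) (F ^ n))"

definition Omega :: "'v series \<Rightarrow> 'v series" where
  "Omega A = series_exp (locally_finite_sum (\<lambda>k.
     if k \<ge> 1 then series_scale (1 / of_nat k) (power_plethysm k A) else 0))"

section \<open>Symmetric functions\<close>

text \<open>The indeterminates $x_1, x_2, \dots$ are indexed by the type \<^typ>\<open>nat\<close>.\<close>

definition Lambda :: "nat series set" where
  "Lambda = {F. (\<forall>\<pi> M. bij \<pi> \<longrightarrow> scoeff F (image_mset \<pi> M) = scoeff F M) \<and>
                (\<exists>d. \<forall>M. scoeff F M \<noteq> 0 \<longrightarrow> size M \<le> d)}"

definition homogeneous_part :: "nat \<Rightarrow> 'v series \<Rightarrow> 'v series" where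
  "homogeneous_part d F = Series (\<lambda>M. if size M = d then scoeff F M else 0)"

text \<open>The complete homogeneous symmetric function of degree \<open>r\<close>; it is zero for \<open>r < 0\<close>.\<close>

definition complete_homogeneous :: "int \<Rightarrow> nat series" where
  "complete_homogeneous r = Series (\<lambda>M. if int (size M) = r then 1 else 0)"

text \<open>Lists are indexed from 0, which does not change the differences \<open>j - i\<close>.\<close>

definition schur :: "int list \<Rightarrow> nat series" where
  "schur \<nu> = det (mat (length \<nu>) (length \<nu>)
     (\<lambda>(i, j). complete_homogeneous (\<nu> ! i - int i + int j)))"

definition is_integer_partition :: "int list \<Rightarrow> bool" where
  "is_integer_partition \<mu> \<longleftrightarrow> sorted_wrt (\<ge>) \<mu> \<and> (\<forall>r\<in>set \<mu>. r > 0)"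

definition schur_basis :: "nat series set" where
  "schur_basis = {schur \<mu> | \<mu>. is_integer_partition \<mu>}"

text \<open>The scalar product for which the Schur functions indexed by partitions are orthonormal,
  computed from the coordinates with respect to these functions.\<close>

definition scalar_product :: "nat series \<Rightarrow> nat series \<Rightarrow> rat" where
  "scalar_product P Q = Sum_any (\<lambda>b.
     series.representation schur_basis P b * series.representation schur_basis Q b)"

text \<open>\<open>adjoint P\<close> is the adjoint of multiplication by an element \<open>P\<close> of \<^const>\<open>Lambda\<close>. The operator
  \<open>skew P\<close> extends this to infinite sums of homogeneous pieces; on an element of \<^const>\<open>Lambda\<close> only
  finitely many pieces act nontrivially, because the piece of degree \<open>d\<close> lowers degrees by \<open>d\<close>.\<close>

definition adjoint :: "nat series \<Rightarrow> nat series \<Rightarrow> nat series" where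
  "adjoint P Q = (THE R. R \<in> Lambda \<and>
     (\<forall>S\<in>Lambda. scalar_product R S = scalar_product Q (P * S)))"

definition skew :: "nat series \<Rightarrow> nat series \<Rightarrow> nat series" where
  "skew P Q = Sum_any (\<lambda>d. adjoint (homogeneous_part d P) Q)"

section \<open>The four symbols\<close>

datatype diamond = Empty | Box | Hdomino | Vdomino

fun f_diamond :: "diamond \<Rightarrow> nat series" where
  "f_diamond Empty = 0"
| "f_diamond Box = schur [1] + schur [1, 1]"
| "f_diamond Hdomino = schur [2]"
| "f_diamond Vdomino = schur [1, 1]"

definition schur_diamond :: "diamond \<Rightarrow> int list \<Rightarrow> nat series" where
  "schur_diamond D \<nu> = skew (Omega (- f_diamond D)) (schur \<nu>)"

section \<open>Bernstein's operators\<close>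

text \<open>Series with one auxiliary indeterminate \<open>None\<close> besides the $x_i$, which are now \<open>Some i\<close>.
  The auxiliary indeterminate stands for $z$ in $\Omega[zX]$ and for $z^{-1}$ in $\Omega[-z^{-1}X]$,
  so that both are power series in it.\<close>

definition auxX :: "nat option series" where
  "auxX = Series (\<lambda>M. if (\<exists>i. M = {#None, Some i#}) then 1 else 0)"

definition aux_coeff :: "nat \<Rightarrow> nat option series \<Rightarrow> nat series" where
  "aux_coeff j F = Series (\<lambda>M. scoeff F (image_mset Some M + replicate_mset j None))"

text \<open>The coefficient of $z^r$ in $\Omega[zX]\,\Omega[-z^{-1}X]^\perp$ collects the products of the
  coefficient of $z^i$ in the first factor and of $z^{-j}$ in the second one, where \<open>i - j = r\<close>.\<close>

definition bernstein :: "int \<Rightarrow> nat series \<Rightarrow> nat series" where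
  "bernstein r P = Sum_any (\<lambda>(i, j).
     if int i - int j = r
     then aux_coeff i (Omega auxX) * skew (aux_coeff j (Omega (- auxX))) P
     else 0)"

definition bernstein_list :: "int list \<Rightarrow> nat series \<Rightarrow> nat series" where
  "bernstein_list \<nu> = foldr (\<lambda>r T. bernstein r \<circ> T) \<nu> id"

definition bernstein_diamond :: "diamond \<Rightarrow> int list \<Rightarrow> nat series \<Rightarrow> nat series" where
  "bernstein_diamond D \<nu> = skew (Omega (- f_diamond D)) \<circ> bernstein_list \<nu> \<circ> skew (Omega (f_diamond D))"

end

theory Submission
  imports Defs
begin

text \<open>The scalar product of the Jacobi--Trudi determinant \<open>s\<^sub>\<nu>\<close> of an integer vector \<open>\<nu>\<close> with a symmetric
  function is the alternating sum over the permutations \<open>w\<close> of its coefficients at the exponents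
  \<open>\<nu> i - i + w i\<close>: by the bialternant formula these functionals are dual to the Schur functions of
  partitions, and both sides change in the same way when \<open>\<nu>\<close> is straightened. Hence skewing \<open>s\<^sub>\<nu>\<close> by
  the elementary symmetric function of degree \<open>j\<close> gives the sum of all determinants with \<open>j\<close> rows
  lowered by one, which is a minor of the matrix belonging to \<open>(r, \<nu>)\<close>, and Laplace expansion along the
  first row shows that \<open>B\<^sub>r\<close> maps \<open>s\<^sub>\<nu>\<close> to \<open>s\<close> of \<open>(r, \<nu>)\<close>. Skewing by \<open>\<Omega>[f]\<close> and by \<open>\<Omega>[-f]\<close> are mutually
  inverse, so the product of the operators telescopes.\<close>

section \<open>Calculus of formal series and of the plethystic exponential\<close>

section \<open>Coefficients\<close>

text \<open>The scalar product is defined by coordinates in the Schur basis and the adjoint by a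
  definite description, so nothing can be computed before the Schur functions of partitions are
  known to be a basis of \<open>Lambda\<close>. The functionals \<open>schur_dual\<close>, explicit
  in coefficients, break this circle: orthonormality gives independence, and spanning follows
  because only 0 is annihilated by all of them.

  The duality for such vectors is reduced to partitions by an abstract notion,
  \<open>stable_family\<close>, of which the determinant and the functional are two instances.

  The series \<open>Omega (f_diamond D)\<close> has in general unbounded degree. Skewing by it is
  governed by pairings with products truncated at the degree of the argument; its symmetry, its
  constant term 1 and its inverse are what enters. Explicit coefficients are computed only for the
  generating functions of Bernstein's operators, those of \<open>Omega auxX\<close> from a linear
  differential equation.\<close>

lemma scoeff_zero [simp]: "scoeff 0 M = 0"
  by (simp add: zero_series_def)

lemma scoeff_one: "scoeff 1 M = (if M = {#} then 1 else 0)"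
  by (simp add: one_series_def)

lemma scoeff_add [simp]: "scoeff (F + G) M = scoeff F M + scoeff G M"
  by (simp add: plus_series_def)

lemma scoeff_diff [simp]: "scoeff (F - G) M = scoeff F M - scoeff G M"
  by (simp add: minus_series_def)

lemma scoeff_uminus [simp]: "scoeff (- F) M = - scoeff F M"
  by (simp add: uminus_series_def)

lemma scoeff_scale [simp]: "scoeff (series_scale c F) M = c * scoeff F M"
  by (simp add: series_scale_def)

lemma scoeff_times: "scoeff (F * G) M = (\<Sum>A | A \<subseteq># M. scoeff F A * scoeff G (M - A))"
  by (simp add: times_series_def)

lemma scoeff_sum [simp]: "scoeff (sum f I) M = (\<Sum>i\<in>I. scoeff (f i) M)"
  by (induction I rule: infinite_finite_induct) auto

lemma scoeff_times_nonzeroE: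
  assumes "scoeff (F * G) M \<noteq> 0"
  obtains A B where "M = A + B" "scoeff F A \<noteq> 0" "scoeff G B \<noteq> 0"
proof -
  obtain A where "A \<in> {A. A \<subseteq># M}" "scoeff F A * scoeff G (M - A) \<noteq> 0"
    by (rule sum.not_neutral_contains_not_neutral[OF assms[unfolded scoeff_times]])
  then show thesis by (intro that[of A "M - A"]) auto
qed

lemma scoeff_times_empty [simp]: "scoeff (F * G) {#} = scoeff F {#} * scoeff G {#}"
  by (simp add: scoeff_times)

lemma series_scale_mult_left [simp]: "series_scale c F * G = series_scale c (F * G)"
  by (rule series_eqI) (simp add: scoeff_times sum_distrib_left mult.assoc)

lemma series_scale_mult_right [simp]: "F * series_scale c G = series_scale c (F * G)"
  by (metis mult.commute series_scale_mult_left)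

section \<open>The exponential\<close>

text \<open>Without a constant term, each of the \<open>n\<close> factors uses up at least one
  indeterminate of the monomial. This makes the exponential series locally finite.\<close>

lemma scoeff_power_eq_0:
  assumes "scoeff F {#} = 0" "size M < n"
  shows "scoeff (F ^ n) M = 0"
  using assms(2)
proof (induction n arbitrary: M)
  case (Suc n)
  have "scoeff F A * scoeff (F ^ n) (M - A) = 0" if "A \<subseteq># M" for A
  proof (cases "A = {#}")
    case False
    have "size (M - A) < size M"
      using that False
      by (metis diff_less nonempty_has_size size_Diff_submset size_mset_mono less_le_trans)
    then have "size (M - A) < n" using Suc.prems by simp
    then show ?thesis by (simp add: Suc.IH)
  qed (simp add: assms(1))
  then show ?case by (unfold power_Suc scoeff_times, intro sum.neutral, blast)
qed simp

text \<open>In degrees up to \<open>D\<close> this agrees with the exponential, so computations with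
  the locally finite sum can be done on a finite one.\<close>

definition exp_partial_sum :: "nat \<Rightarrow> 'v series \<Rightarrow> 'v series" where
  "exp_partial_sum D F = (\<Sum>n\<le>D. series_scale (1 / fact n) (F ^ n))"

lemma scoeff_series_exp:
  assumes "scoeff F {#} = 0" "size M \<le> D"
  shows "scoeff (series_exp F) M = scoeff (exp_partial_sum D F) M"
proof -
  have "Sum_any (\<lambda>n. scoeff (series_scale (1 / fact n) (F ^ n)) M)
      = (\<Sum>n\<le>D. scoeff (series_scale (1 / fact n) (F ^ n)) M)"
  proof (rule Sum_any.expand_superset)
    show "{n. scoeff (series_scale (1 / fact n) (F ^ n)) M \<noteq> 0} \<subseteq> {..D}"
    proof clarsimp
      fix n assume "scoeff (F ^ n) M \<noteq> 0"
      then show "n \<le> D"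
        using scoeff_power_eq_0[OF assms(1), of M n] assms(2) by fastforce
    qed
  qed simp
  then show ?thesis
    by (simp add: series_exp_def locally_finite_sum_def exp_partial_sum_def)
qed

lemma scoeff_times_series_exp:
  assumes "scoeff F {#} = 0" "size M \<le> D"
  shows "scoeff (G * series_exp F) M = scoeff (G * exp_partial_sum D F) M"
  unfolding scoeff_times
proof (rule sum.cong)
  fix A assume "A \<in> {A. A \<subseteq># M}"
  then have "size (M - A) \<le> D"
    using assms(2) by (meson diff_subset_eq_self le_trans size_mset_mono)
  then show "scoeff G A * scoeff (series_exp F) (M - A)
      = scoeff G A * scoeff (exp_partial_sum D F) (M - A)"
    by (simp add: scoeff_series_exp[OF assms(1)])
qed simp

text \<open>The Euler operator multiplies the homogeneous part of degree \<open>d\<close> by \<open>d\<close>. It is a derivation,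
  which turns identities between exponentials into linear differential equations.\<close>

definition euler :: "'v series \<Rightarrow> 'v series" where
  "euler F = Series (\<lambda>M. of_nat (size M) * scoeff F M)"

lemma scoeff_euler [simp]: "scoeff (euler F) M = of_nat (size M) * scoeff F M"
  by (simp add: euler_def)

lemma euler_mult: "euler (F * G) = euler F * G + F * euler G"
proof (rule series_eqI)
  fix M
  have "of_nat (size M) * (scoeff F A * scoeff G (M - A))
      = of_nat (size A) * scoeff F A * scoeff G (M - A)
      + scoeff F A * (of_nat (size (M - A)) * scoeff G (M - A))" if "A \<subseteq># M" for A
  proof -
    have "size M = size A + size (M - A)"
      using that by (metis size_union subset_mset.add_diff_inverse)
    then show ?thesis by (simp add: algebra_simps)
  qed
  then show "scoeff (euler (F * G)) M = scoeff (euler F * G + F * euler G) M"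
    by (simp add: scoeff_times sum_distrib_left sum.distrib[symmetric])
qed

lemma euler_one [simp]: "euler 1 = 0"
  by (rule series_eqI) (simp add: scoeff_one)

lemma euler_uminus [simp]: "euler (- F) = - euler F"
  by (rule series_eqI) simp

lemma euler_scale [simp]: "euler (series_scale c F) = series_scale c (euler F)"
  by (rule series_eqI) simp

lemma euler_sum: "euler (sum f I) = (\<Sum>i\<in>I. euler (f i))"
  by (rule series_eqI) (simp add: sum_distrib_left)

lemma euler_power_Suc: "euler (F ^ Suc n) = series_scale (of_nat (Suc n)) (euler F * F ^ n)"
proof (induction n)
  case (Suc n)
  have "euler (F ^ Suc (Suc n)) = euler F * F ^ Suc n + F * euler (F ^ Suc n)"
    by (subst power_Suc) (rule euler_mult)
  also have "F * euler (F ^ Suc n) = series_scale (of_nat (Suc n)) (euler F * F ^ Suc n)"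
    unfolding Suc.IH by (simp add: ac_simps)
  also have "euler F * F ^ Suc n + \<dots> = series_scale (of_nat (Suc (Suc n))) (euler F * F ^ Suc n)"
    by (rule series_eqI) (simp add: distrib_right)
  finally show ?case .
qed (simp add: series_eqI)

lemma euler_exp_partial_sum:
  "euler (exp_partial_sum (Suc D) F) = euler F * exp_partial_sum D F"
proof -
  have "euler (series_scale (1 / fact (Suc n)) (F ^ Suc n))
      = euler F * series_scale (1 / fact n) (F ^ n)" for n
    unfolding euler_scale euler_power_Suc
    by (rule series_eqI) (simp del: of_nat_Suc)
  then show ?thesis
    unfolding exp_partial_sum_def euler_sum sum_distrib_left
    by (subst sum.atMost_Suc_shift) simp
qed

lemma euler_series_exp:
  assumes "scoeff F {#} = 0"
  shows "euler (series_exp F) = euler F * series_exp F"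
proof (rule series_eqI)
  fix M
  have "scoeff (euler (series_exp F)) M = scoeff (euler (exp_partial_sum (Suc (size M)) F)) M"
    by (simp add: scoeff_series_exp[OF assms, of M "Suc (size M)"])
  also have "\<dots> = scoeff (euler F * series_exp F) M"
    unfolding euler_exp_partial_sum by (rule scoeff_times_series_exp[OF assms, symmetric]) simp
  finally show "scoeff (euler (series_exp F)) M = scoeff (euler F * series_exp F) M" .
qed

text \<open>Since \<open>G\<close> has no constant term, the coefficient of \<open>G * U\<close> at
  \<open>M\<close> involves only coefficients of \<open>U\<close> at smaller monomials. The equation
  thus is a recursion for \<open>size M\<close> times the coefficient at \<open>M\<close>, and
  \<open>size M\<close> can be cancelled unless \<open>M\<close> is empty.\<close>

lemma euler_equation_unique:
  assumes "euler U = G * U" "euler V = G * V" "scoeff G {#} = 0" "scoeff U {#} = scoeff V {#}"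
  shows "U = V"
proof (rule series_eqI)
  fix M
  show "scoeff U M = scoeff V M"
  proof (induction "size M" arbitrary: M rule: less_induct)
    case less
    show ?case
    proof (cases "M = {#}")
      case False
      have "scoeff G A * scoeff U (M - A) = scoeff G A * scoeff V (M - A)" if "A \<subseteq># M" for A
      proof (cases "A = {#}")
        case False
        then have "size (M - A) < size M"
          using that by (metis diff_less nonempty_has_size size_Diff_submset size_mset_mono less_le_trans)
        then show ?thesis using less by simp
      qed (simp add: assms(3))
      then have "scoeff (G * U) M = scoeff (G * V) M"
        unfolding scoeff_times by (intro sum.cong) auto
      then have "of_nat (size M) * scoeff U M = of_nat (size M) * scoeff V M"
        by (metis assms(1,2) scoeff_euler)
      then show ?thesis using False by simp
    qed (simp add: assms(4))
  qed
qed

lemma scoeff_series_exp_empty: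
  "scoeff F {#} = 0 \<Longrightarrow> scoeff (series_exp F) {#} = 1"
  by (simp add: scoeff_series_exp[of F "{#}" 0] exp_partial_sum_def scoeff_one)

text \<open>The Euler operator annihilates the product, just as it annihilates \<open>1\<close>, and
  the constant terms agree.\<close>

lemma series_exp_uminus_mult:
  assumes "scoeff F {#} = 0"
  shows "series_exp (- F) * series_exp F = 1"
proof (rule euler_equation_unique[of _ 0])
  show "euler (series_exp (- F) * series_exp F) = 0 * (series_exp (- F) * series_exp F)"
    using assms by (simp add: euler_mult euler_series_exp)
qed (use assms in \<open>simp_all add: scoeff_series_exp_empty scoeff_one\<close>)

section \<open>The plethystic exponential\<close>

definition plethystic_log :: "'v series \<Rightarrow> 'v series" where
  "plethystic_log A = locally_finite_sum (\<lambda>k.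
     if k \<ge> 1 then series_scale (1 / of_nat k) (power_plethysm k A) else 0)"

lemma Omega_eq: "Omega A = series_exp (plethystic_log A)"
  by (simp add: Omega_def plethystic_log_def)

lemma scoeff_plethystic_log:
  "scoeff (plethystic_log A) M
    = Sum_any (\<lambda>k. if k \<ge> 1 then 1 / of_nat k * (\<Sum>N | repeat_mset k N = M. scoeff A N) else 0)"
  unfolding plethystic_log_def locally_finite_sum_def scoeff_Series
  by (rule arg_cong[where f = Sum_any]) (auto simp: power_plethysm_def)

lemma plethystic_log_uminus: "plethystic_log (- A) = - plethystic_log A"
proof (rule series_eqI)
  fix M
  have "scoeff (plethystic_log (- A)) M = Sum_any (\<lambda>k. -
      (if k \<ge> 1 then 1 / of_nat k * (\<Sum>N | repeat_mset k N = M. scoeff A N) else 0))"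
    unfolding scoeff_plethystic_log by (rule arg_cong[where f = Sum_any]) (auto simp: sum_negf)
  \<comment> \<open>Negation does not change the support of the family, so it commutes with
    \<open>Sum_any\<close> without any finiteness argument.\<close>
  also have "\<dots> = scoeff (- plethystic_log A) M"
    unfolding scoeff_uminus scoeff_plethystic_log Sum_any.expand_set by (simp add: sum_negf)
  finally show "scoeff (plethystic_log (- A)) M = scoeff (- plethystic_log A) M" .
qed

lemma scoeff_plethystic_log_empty:
  assumes "scoeff A {#} = 0"
  shows "scoeff (plethystic_log A) {#} = 0"
proof -
  have "(\<Sum>N | repeat_mset k N = {#}. scoeff A N) = 0" if "k \<ge> 1" for k
    using that assms by (simp add: repeat_mset_eq_empty_iff)
  then show ?thesis
    unfolding scoeff_plethystic_log by (simp cong: if_cong)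
qed

lemma scoeff_Omega_empty: "scoeff A {#} = 0 \<Longrightarrow> scoeff (Omega A) {#} = 1"
  by (simp add: Omega_eq scoeff_series_exp_empty scoeff_plethystic_log_empty)

lemma Omega_uminus_mult: "scoeff A {#} = 0 \<Longrightarrow> Omega (- A) * Omega A = 1"
  by (simp add: Omega_eq plethystic_log_uminus series_exp_uminus_mult scoeff_plethystic_log_empty)

section \<open>Symmetry, and the complete and elementary symmetric functions\<close>

section \<open>Permuting the indeterminates\<close>

text \<open>Coefficients are read at \<open>image_mset \<pi> M\<close>, so for a bijection this is
  substitution by the inverse of \<open>\<pi>\<close>. As a ring homomorphism compatible with
  plethysm it carries symmetry through \<open>Omega\<close> without knowledge of any
  coefficient.\<close>

definition permute_series :: "('v \<Rightarrow> 'v) \<Rightarrow> 'v series \<Rightarrow> 'v series" where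
  "permute_series \<pi> F = Series (\<lambda>M. scoeff F (image_mset \<pi> M))"

definition symmetric_series :: "'v series \<Rightarrow> bool" where
  "symmetric_series F \<longleftrightarrow> (\<forall>\<pi>. bij \<pi> \<longrightarrow> permute_series \<pi> F = F)"

lemma scoeff_permute [simp]: "scoeff (permute_series \<pi> F) M = scoeff F (image_mset \<pi> M)"
  by (simp add: permute_series_def)

lemma symmetric_seriesD:
  "symmetric_series F \<Longrightarrow> bij \<pi> \<Longrightarrow> scoeff F (image_mset \<pi> M) = scoeff F M"
  by (metis scoeff_permute symmetric_series_def)

lemma symmetric_seriesI:
  "(\<And>\<pi> M. bij \<pi> \<Longrightarrow> scoeff F (image_mset \<pi> M) = scoeff F M) \<Longrightarrow> symmetric_series F"
  by (auto simp: symmetric_series_def intro: series_eqI)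

lemma image_mset_bij_inv:
  assumes "bij \<pi>"
  shows "image_mset \<pi> (image_mset (inv_into UNIV \<pi>) M) = M" "image_mset (inv_into UNIV \<pi>) (image_mset \<pi> M) = M"
  using assms by (simp_all add: multiset.map_comp o_def bij_is_surj surj_f_inv_f bij_is_inj inv_f_f)

lemma image_mset_repeat: "image_mset f (repeat_mset k N) = repeat_mset k (image_mset f N)"
  by (induction k) simp_all

lemma image_mset_Diff_bij:
  assumes "bij \<pi>" "A \<subseteq># M"
  shows "image_mset \<pi> (M - A) = image_mset \<pi> M - image_mset \<pi> A"
  by (simp add: assms(2) image_mset_Diff)

lemma permute_series_mult:
  assumes "bij \<pi>"
  shows "permute_series \<pi> (F * G) = permute_series \<pi> F * permute_series \<pi> G"
proof (rule series_eqI)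
  fix M
  have "(\<Sum>A | A \<subseteq># image_mset \<pi> M. scoeff F A * scoeff G (image_mset \<pi> M - A))
      = (\<Sum>A | A \<subseteq># M. scoeff F (image_mset \<pi> A) * scoeff G (image_mset \<pi> (M - A)))"
  proof (rule sum.reindex_bij_witness[of _ "image_mset \<pi>" "image_mset (inv_into UNIV \<pi>)"])
    fix A assume "A \<in> {A. A \<subseteq># image_mset \<pi> M}"
    then show A: "image_mset (inv_into UNIV \<pi>) A \<in> {A. A \<subseteq># M}"
      using image_mset_subseteq_mono[of A "image_mset \<pi> M" "inv_into UNIV \<pi>"]
      by (simp add: image_mset_bij_inv[OF assms])
    then show "scoeff F (image_mset \<pi> (image_mset (inv_into UNIV \<pi>) A))
        * scoeff G (image_mset \<pi> (M - image_mset (inv_into UNIV \<pi>) A))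
        = scoeff F A * scoeff G (image_mset \<pi> M - A)"
      using image_mset_Diff_bij[OF assms, of "image_mset (inv_into UNIV \<pi>) A" M]
      by (simp only: image_mset_bij_inv[OF assms] mem_Collect_eq)
  qed (auto simp: image_mset_bij_inv[OF assms] intro: image_mset_subseteq_mono)
  then show "scoeff (permute_series \<pi> (F * G)) M
      = scoeff (permute_series \<pi> F * permute_series \<pi> G) M"
    by (simp add: scoeff_times)
qed

lemma permute_series_one [simp]: "permute_series \<pi> 1 = 1"
  by (rule series_eqI) (simp add: scoeff_one)

lemma permute_series_power:
  "bij \<pi> \<Longrightarrow> permute_series \<pi> (F ^ n) = permute_series \<pi> F ^ n"
  by (induction n) (simp_all add: permute_series_mult)

lemma permute_series_scale [simp]:
  "permute_series \<pi> (series_scale c F) = series_scale c (permute_series \<pi> F)"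
  by (rule series_eqI) simp

lemma permute_series_zero [simp]: "permute_series \<pi> 0 = 0"
  by (rule series_eqI) simp

lemma permute_locally_finite_sum:
  "permute_series \<pi> (locally_finite_sum F) = locally_finite_sum (\<lambda>n. permute_series \<pi> (F n))"
  by (simp add: permute_series_def locally_finite_sum_def)

lemma permute_power_plethysm:
  assumes "bij \<pi>"
  shows "permute_series \<pi> (power_plethysm k A) = power_plethysm k (permute_series \<pi> A)"
proof (rule series_eqI)
  fix M
  have "(\<Sum>N | repeat_mset k N = image_mset \<pi> M. scoeff A N)
      = (\<Sum>N | repeat_mset k N = M. scoeff A (image_mset \<pi> N))"
    by (rule sum.reindex_bij_witness[of _ "image_mset \<pi>" "image_mset (inv_into UNIV \<pi>)"])
      (use image_mset_bij_inv[OF assms] in \<open>simp_all flip: image_mset_repeat\<close>)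
  then show "scoeff (permute_series \<pi> (power_plethysm k A)) M
      = scoeff (power_plethysm k (permute_series \<pi> A)) M"
    by (simp add: power_plethysm_def)
qed

lemma permute_Omega:
  assumes "bij \<pi>"
  shows "permute_series \<pi> (Omega A) = Omega (permute_series \<pi> A)"
  unfolding Omega_def series_exp_def permute_locally_finite_sum permute_series_scale
    permute_series_power[OF assms]
  by (simp add: if_distrib permute_power_plethysm[OF assms] cong: if_cong)

lemma symmetric_Omega: "symmetric_series A \<Longrightarrow> symmetric_series (Omega A)"
  by (simp add: symmetric_series_def permute_Omega)

lemma symmetric_mult:
  "symmetric_series F \<Longrightarrow> symmetric_series G \<Longrightarrow> symmetric_series (F * G)"
  by (simp add: symmetric_series_def permute_series_mult)

lemma symmetric_add:
  "symmetric_series F \<Longrightarrow> symmetric_series G \<Longrightarrow> symmetric_series (F + G)"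
  by (rule symmetric_seriesI) (simp add: symmetric_seriesD)

lemma symmetric_uminus: "symmetric_series F \<Longrightarrow> symmetric_series (- F)"
  by (rule symmetric_seriesI) (simp add: symmetric_seriesD)

lemma symmetric_scale: "symmetric_series F \<Longrightarrow> symmetric_series (series_scale c F)"
  by (rule symmetric_seriesI) (simp add: symmetric_seriesD)

lemma symmetric_zero [simp]: "symmetric_series 0"
  by (rule symmetric_seriesI) simp

lemma symmetric_one [simp]: "symmetric_series 1"
  by (simp add: symmetric_series_def)

section \<open>Complete and elementary symmetric functions\<close>

text \<open>Expansion of the product of the factors \<open>1 - 1\<close> over
  \<open>U\<close>.\<close>

lemma sum_alternating_subsets:
  assumes "finite U"
  shows "(\<Sum>S | S \<subseteq> U. (-1) ^ card S) = (if U = {} then 1 else 0 :: 'a :: comm_ring_1)"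
proof -
  have "(\<Prod>x\<in>U. 1 - 1 :: 'a) = (\<Sum>S\<in>Pow U. (-1) ^ card S * (\<Prod>x\<in>S. 1) * (\<Prod>x\<in>U-S. 1))"
    by (rule prod_diff_conv_sum[OF assms])
  then show ?thesis
    using assms by (auto simp: Pow_def power_0_left)
qed

lemma scoeff_minus_one_power_mult [simp]:
  "scoeff ((-1) ^ c * F) M = (-1) ^ c * scoeff F M"
  by (induction c) simp_all

text \<open>The set \<open>T\<close> of admissible indeterminates is a parameter:
  \<open>UNIV\<close> serves for Bernstein's operators, all but one of the first \<open>N\<close>
  indeterminates for the bialternant formula.\<close>

definition elementary :: "'v set \<Rightarrow> nat \<Rightarrow> 'v series" where
  "elementary T j =
    Series (\<lambda>M. if \<exists>S. S \<subseteq> T \<and> finite S \<and> card S = j \<and> M = mset_set S then 1 else 0)"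

lemma mset_set_subseteq_iff:
  assumes "finite S"
  shows "mset_set S \<subseteq># M \<longleftrightarrow> S \<subseteq> set_mset M"
proof
  assume "mset_set S \<subseteq># M"
  then show "S \<subseteq> set_mset M"
    using assms set_mset_mono by fastforce
next
  assume "S \<subseteq> set_mset M"
  then have "mset_set S \<subseteq># mset_set (set_mset M)"
    by (simp add: subset_imp_msubset_mset_set)
  then show "mset_set S \<subseteq># M"
    using mset_set_set_mset_msubset subset_mset.order_trans by blast
qed

lemma scoeff_elementary_mult:
  "scoeff (elementary T j * F) M
    = (\<Sum>S | S \<subseteq> T \<inter> set_mset M \<and> card S = j. scoeff F (M - mset_set S))"
proof -
  let ?\<S> = "{S. S \<subseteq> T \<inter> set_mset M \<and> card S = j}"
  have fin: "finite S" if "S \<in> ?\<S>" for S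
    using that by (auto intro: finite_subset[of _ "set_mset M"])
  have inj: "inj_on mset_set ?\<S>"
    by (rule inj_onI) (use fin in \<open>simp del: mem_Collect_eq\<close>)
  have "scoeff (elementary T j * F) M = (\<Sum>A\<in>mset_set ` ?\<S>. scoeff F (M - A))"
    unfolding scoeff_times
  proof (rule sum.mono_neutral_cong_right)
    show "mset_set ` ?\<S> \<subseteq> {A. A \<subseteq># M}"
    proof (intro image_subsetI CollectI)
      fix S assume S: "S \<in> ?\<S>"
      then show "mset_set S \<subseteq># M" using fin[OF S] by (simp add: mset_set_subseteq_iff)
    qed
    show "\<forall>A\<in>{A. A \<subseteq># M} - mset_set ` ?\<S>. scoeff (elementary T j) A * scoeff F (M - A) = 0"
    proof
      fix A assume A: "A \<in> {A. A \<subseteq># M} - mset_set ` ?\<S>"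
      have "\<not> (\<exists>S. S \<subseteq> T \<and> finite S \<and> card S = j \<and> A = mset_set S)"
      proof (intro notI, elim exE conjE)
        fix S assume "S \<subseteq> T" "finite S" "card S = j" "A = mset_set S"
        with A have "S \<in> ?\<S>" by (simp add: mset_set_subseteq_iff)
        with A \<open>A = mset_set S\<close> show False by blast
      qed
      then have "scoeff (elementary T j) A = 0"
        by (simp only: elementary_def scoeff_Series if_False)
      then show "scoeff (elementary T j) A * scoeff F (M - A) = 0" by simp
    qed
    fix A assume "A \<in> mset_set ` ?\<S>"
    then obtain S where "S \<in> ?\<S>" "A = mset_set S" by blast
    then have "scoeff (elementary T j) A = 1"
      using fin[of S] by (auto simp: elementary_def)
    then show "scoeff (elementary T j) A * scoeff F (M - A) = scoeff F (M - A)" by simp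
  qed (rule finite_submultisets)
  then show ?thesis by (simp only: sum.reindex[OF inj] o_def)
qed

text \<open>Multiplying the generating function of the complete functions by \<open>1 - t x\<close>
  for every \<open>x\<close> in \<open>T\<close> removes these indeterminates, which leaves the
  complete homogeneous function of degree \<open>m\<close> in the others. On a single monomial this
  is inclusion-exclusion over the members of \<open>T\<close> that occur in it, and \<open>n\<close>
  bounds their number.\<close>

lemma sum_elementary_mult_complete_homogeneous:
  assumes "\<And>M. int (size M) = m \<Longrightarrow> card (T \<inter> set_mset M) \<le> n"
  shows "(\<Sum>c\<le>n. (-1) ^ c * (elementary T c * complete_homogeneous (m - int c)))
    = Series (\<lambda>M. if int (size M) = m \<and> T \<inter> set_mset M = {} then 1 else 0)"
proof (rule series_eqI)
  fix M :: "nat multiset"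
  let ?U = "T \<inter> set_mset M"
  have fin: "finite ?U" by simp
  have "scoeff (elementary T c * complete_homogeneous (m - int c)) M
      = (\<Sum>S | S \<subseteq> ?U \<and> card S = c. if int (size M) = m then 1 else 0)" for c
    unfolding scoeff_elementary_mult
  proof (rule sum.cong)
    fix S assume S: "S \<in> {S. S \<subseteq> ?U \<and> card S = c}"
    then have "finite S" using fin finite_subset by blast
    then have "mset_set S \<subseteq># M" using S by (simp add: mset_set_subseteq_iff)
    then have "size M = size (M - mset_set S) + c"
      using S \<open>finite S\<close> by (metis (mono_tags, lifting) mem_Collect_eq size_mset_set size_union
        subset_mset.diff_add)
    then show "scoeff (complete_homogeneous (m - int c)) (M - mset_set S)
        = (if int (size M) = m then 1 else 0)"
      by (auto simp: complete_homogeneous_def)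
  qed simp
  then have "scoeff (\<Sum>c\<le>n. (-1) ^ c * (elementary T c * complete_homogeneous (m - int c))) M
      = (\<Sum>c\<le>n. \<Sum>S | S \<subseteq> ?U \<and> card S = c. if int (size M) = m then (-1) ^ card S else 0)"
    by (auto simp: sum_distrib_left intro!: sum.cong)
  also have "\<dots> = (if int (size M) = m \<and> ?U = {} then 1 else 0)"
  proof (cases "int (size M) = m")
    case True
    have "(\<Sum>c\<le>n. \<Sum>S | S \<subseteq> ?U \<and> card S = c. (-1) ^ card S)
        = (\<Sum>S | S \<subseteq> ?U. (-1) ^ card S :: rat)"
    proof -
      have "card ` {S. S \<subseteq> ?U} \<subseteq> {..n}"
      proof (intro image_subsetI)
        fix S assume "S \<in> {S. S \<subseteq> ?U}"
        then have "card S \<le> card ?U" by (intro card_mono[OF fin]) simp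
        then show "card S \<in> {..n}" using assms[OF True] by simp
      qed
      then show ?thesis
        using sum.group[of "{S. S \<subseteq> ?U}" "{..n}" card "\<lambda>S. (-1) ^ card S :: rat"] by simp
    qed
    then show ?thesis
      using True sum_alternating_subsets[OF fin, where 'a = rat] by simp
  qed simp
  finally show "scoeff (\<Sum>c\<le>n. (-1) ^ c * (elementary T c * complete_homogeneous (m - int c))) M
      = scoeff (Series (\<lambda>M. if int (size M) = m \<and> T \<inter> set_mset M = {} then 1 else 0)) M"
    by simp
qed

lemma complete_homogeneous_0 [simp]: "complete_homogeneous 0 = 1"
  by (rule series_eqI) (simp add: complete_homogeneous_def scoeff_one)

lemma complete_homogeneous_neg [simp]: "r < 0 \<Longrightarrow> complete_homogeneous r = 0"
  by (rule series_eqI) (simp add: complete_homogeneous_def)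

lemma symmetric_complete_homogeneous: "symmetric_series (complete_homogeneous r)"
  by (rule symmetric_seriesI) (simp add: complete_homogeneous_def)

lemma symmetric_elementary: "symmetric_series (elementary UNIV j)"
proof (rule symmetric_seriesI)
  fix \<pi> :: "'a \<Rightarrow> 'a" and M
  assume \<pi>: "bij \<pi>"
  have img: "image_mset \<rho> (mset_set S) = mset_set (\<rho> ` S)" if "bij \<rho>" for \<rho> :: "'a \<Rightarrow> 'a" and S
    using that by (meson bij_is_inj image_mset_mset_set inj_on_subset subset_UNIV)
  have "(\<exists>S. finite S \<and> card S = j \<and> image_mset \<pi> M = mset_set S)
      \<longleftrightarrow> (\<exists>S. finite S \<and> card S = j \<and> M = mset_set S)"
  proof (intro iffI; elim exE conjE)
    fix S assume S: "finite S" "card S = j" "image_mset \<pi> M = mset_set S"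
    have inv: "bij (inv_into UNIV \<pi>)" by (simp add: \<pi> bij_imp_bij_inv)
    have "M = mset_set (inv_into UNIV \<pi> ` S)"
      using S(3) image_mset_bij_inv(2)[OF \<pi>, of M] img[OF inv, of S] by simp
    moreover have "card (inv_into UNIV \<pi> ` S) = j"
      using S(2) inv by (meson bij_is_inj card_image inj_on_subset subset_UNIV)
    ultimately show "\<exists>S. finite S \<and> card S = j \<and> M = mset_set S"
      using S(1) by blast
  next
    fix S assume S: "finite S" "card S = j" "M = mset_set S"
    have "card (\<pi> ` S) = j"
      using S(2) \<pi> by (meson bij_is_inj card_image inj_on_subset subset_UNIV)
    then show "\<exists>S. finite S \<and> card S = j \<and> image_mset \<pi> M = mset_set S"
      using S img[OF \<pi>, of S] by blast
  qed
  then show "scoeff (elementary UNIV j) (image_mset \<pi> M) = scoeff (elementary UNIV j) M"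
    by (simp add: elementary_def)
qed

section \<open>Expansion of the generating functions in the auxiliary indeterminate\<close>

section \<open>The coefficients of Bernstein's generating functions\<close>

lemma repeat_mset_eq_mset_iff:
  assumes "k \<ge> 1"
  shows "{N. repeat_mset k N = repeat_mset k M} = {M}"
  using assms by (auto simp: repeat_mset_cancel1)

text \<open>The term \<open>(z x_i)^k\<close> has coefficient \<open>1/k\<close> in the logarithm
  and degree \<open>2k\<close>, hence the value 2 for every \<open>k\<close>.\<close>

lemma scoeff_euler_plethystic_log_auxX:
  "scoeff (euler (plethystic_log auxX)) M
    = (if \<exists>k i. k \<ge> 1 \<and> M = repeat_mset k {#None, Some i#} then 2 else 0)"
proof (cases "\<exists>k i. k \<ge> 1 \<and> M = repeat_mset k {#None, Some i#}")
  case True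
  then obtain k i where k: "k \<ge> 1" and M: "M = repeat_mset k {#None, Some i#}" by blast
  let ?g = "\<lambda>k. if k \<ge> 1
    then 1 / rat_of_nat k * (\<Sum>N | repeat_mset k N = M. scoeff auxX N) else 0"
  have "Sum_any ?g = sum ?g {k}"
  proof (rule Sum_any.expand_superset)
    show "{k'. ?g k' \<noteq> 0} \<subseteq> {k}"
    proof
      fix k' assume "k' \<in> {k'. ?g k' \<noteq> 0}"
      then have "(\<Sum>N | repeat_mset k' N = M. scoeff auxX N) \<noteq> 0"
        by (auto split: if_splits)
      then obtain N where N: "repeat_mset k' N = M" "scoeff auxX N \<noteq> 0"
        by (metis (mono_tags, lifting) mem_Collect_eq sum.neutral)
      then obtain i' where "N = {#None, Some i'#}"
        by (auto simp: auxX_def split: if_splits)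
      then have "size M = 2 * k'" using size_repeat_mset[of k' N] unfolding N(1) by simp
      moreover have "size M = 2 * k" unfolding M size_repeat_mset by simp
      ultimately show "k' \<in> {k}" by simp
    qed
  qed simp
  also have "\<dots> = 1 / of_nat k"
    using k unfolding M repeat_mset_eq_mset_iff[OF k]
    by (simp del: repeat_mset_distrib_add_mset add: repeat_mset_eq_mset_iff[OF k] auxX_def)
  finally have "scoeff (plethystic_log auxX) M = 1 / of_nat k"
    by (simp add: scoeff_plethystic_log)
  moreover have "size M = 2 * k" by (simp add: M)
  ultimately show ?thesis using True k by simp
next
  case False
  have "(\<Sum>N | repeat_mset k N = M. scoeff auxX N) = 0" if "k \<ge> 1" for k
  proof (rule sum.neutral, rule ballI)
    fix N assume "N \<in> {N. repeat_mset k N = M}"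
    then have "\<not> (\<exists>i. N = {#None, Some i#})" using False that by blast
    then show "scoeff auxX N = 0" by (simp only: auxX_def scoeff_Series if_False)
  qed
  then have "scoeff (plethystic_log auxX) M = 0"
    unfolding scoeff_plethystic_log by (simp cong: if_cong)
  with False show ?thesis by simp
qed

text \<open>The right-hand side is the sum of all \<open>z^m h_m\<close>: a monomial is balanced
  when \<open>z\<close> occurs as often as all the \<open>x_i\<close> together. Checking the Euler
  equation amounts to counting the divisors \<open>(z x_i)^k\<close> of a balanced monomial.\<close>

lemma Omega_auxX: "Omega auxX = Series (\<lambda>M. if size M = 2 * count M None then 1 else 0)"
  (is "_ = ?H")
proof (rule euler_equation_unique)
  have aux0: "scoeff auxX {#} = 0" by (simp add: auxX_def)
  show "euler (Omega auxX) = euler (plethystic_log auxX) * Omega auxX"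
    by (simp add: Omega_eq euler_series_exp scoeff_plethystic_log_empty aux0)
  show "scoeff (euler (plethystic_log auxX)) {#} = 0" by simp
  show "scoeff (Omega auxX) {#} = scoeff ?H {#}"
    by (simp add: scoeff_Omega_empty aux0)
  show "euler ?H = euler (plethystic_log auxX) * ?H"
  proof (rule series_eqI)
    fix M :: "nat option multiset"
    let ?R = "{A. A \<subseteq># M \<and> (\<exists>k i. k \<ge> 1 \<and> A = repeat_mset k {#None, Some i#})}"
    \<comment> \<open>Such a divisor takes away as many copies of \<open>z\<close> as of the
      \<open>x_i\<close>, so balance is preserved in both directions.\<close>
    have bal: "size (M - A) = 2 * count (M - A) None \<longleftrightarrow> size M = 2 * count M None"
      if R: "A \<in> ?R" for A
    proof -
      obtain k i where A: "A \<subseteq># M" "A = repeat_mset k {#None, Some i#}"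
        using R by blast
      then have "size M = size (M - A) + 2 * k" "count M None = count (M - A) None + k"
        using size_Diff_submset[OF A(1)] size_mset_mono[OF A(1)] mset_subset_eq_count[OF A(1), of None]
        by auto
      then show ?thesis by (simp del: count_diff)
    qed
    have "scoeff (euler (plethystic_log auxX) * ?H) M
        = (\<Sum>A\<in>?R. 2 * scoeff ?H (M - A))"
      unfolding scoeff_times
    proof (rule sum.mono_neutral_cong_right)
      show "finite {A. A \<subseteq># M}" by (rule finite_submultisets)
    qed (use scoeff_euler_plethystic_log_auxX in auto)
    also have "\<dots> = (\<Sum>A\<in>?R. 2 * scoeff ?H M)"
      by (rule sum.cong[OF refl]) (simp only: scoeff_Series bal)
    also have "\<dots> = of_nat (2 * card ?R) * scoeff ?H M" by simp
    also have "\<dots> = of_nat (size M) * scoeff ?H M"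
    proof (cases "size M = 2 * count M None")
      case True
      let ?X = "set_mset M - {None}"
      let ?r = "\<lambda>(x, k). repeat_mset k {#None, x#}"
      have split: "size M = (\<Sum>x\<in>?X. count M x) + count M None"
        using sum.remove[of "set_mset M" None "count M"]
        by (cases "None \<in># M") (simp_all add: size_multiset_overloaded_eq not_in_iff)
      \<comment> \<open>In a balanced monomial \<open>z\<close> occurs at least as often as any
        single \<open>x_i\<close>, so \<open>(z x_i)^k\<close> divides it as soon as
        \<open>x_i^k\<close> does. The number of divisors is therefore the total exponent of the
        \<open>x_i\<close>, half the size.\<close>
      have le: "count M x \<le> count M None" if "x \<in> ?X" for x
        using split True member_le_sum[OF that, of "count M"] by simp
      have "?R = ?r ` (SIGMA x:?X. {1..count M x})"
      proof (intro equalityI subsetI)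
        fix A assume "A \<in> ?R"
        then obtain k i where k: "A \<subseteq># M" "k \<ge> 1" and A: "A = repeat_mset k {#None, Some i#}"
          by blast
        have "k \<le> count M (Some i)"
          using mset_subset_eq_count[OF k(1), of "Some i"] by (simp add: A)
        moreover from this have "Some i \<in> ?X"
          using k(2) by (auto simp: count_greater_zero_iff[symmetric] simp del: count_greater_zero_iff)
        ultimately show "A \<in> ?r ` (SIGMA x:?X. {1..count M x})"
          using k(2) A by (intro image_eqI[of _ _ "(Some i, k)"]) auto
      next
        fix A assume "A \<in> ?r ` (SIGMA x:?X. {1..count M x})"
        then obtain x k where A: "A = repeat_mset k {#None, x#}" and x: "x \<in> ?X"
          and k: "1 \<le> k" "k \<le> count M x" by fastforce
        obtain i where i: "x = Some i" using x by auto
        have "A \<subseteq># M"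
          using k(2) le[OF x] by (auto simp: subseteq_mset_def A i)
        then show "A \<in> ?R" using A i k(1) by blast
      qed
      moreover have "inj_on ?r (SIGMA x:?X. {1..count M x})"
      proof (rule inj_onI)
        fix p q
        assume p: "p \<in> (SIGMA x:?X. {1..count M x})" and q: "q \<in> (SIGMA x:?X. {1..count M x})"
          and eq: "?r p = ?r q"
        obtain x k y l where pq: "p = (x, k)" "q = (y, l)" by fastforce
        have eq: "repeat_mset k {#None, x#} = repeat_mset l {#None, y#}"
          using eq unfolding pq by (simp only: prod.case)
        have "k = l" using arg_cong[OF eq, of size] by simp
        moreover have "{#None, x#} = {#None, y#}"
          using eq p pq unfolding \<open>k = l\<close> repeat_mset_cancel1 by auto
        ultimately show "p = q" by (simp add: pq)
      qed
      ultimately have "card ?R = card (SIGMA x:?X. {1..count M x})"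
        by (simp only: card_image)
      also have "\<dots> = (\<Sum>x\<in>?X. count M x)" by simp
      finally have "card ?R = (\<Sum>x\<in>?X. count M x)" .
      then show ?thesis using split True by simp
    qed simp
    finally show "scoeff (euler ?H) M = scoeff (euler (plethystic_log auxX) * ?H) M"
      by simp
  qed
qed

lemma option_mset_cases: "\<exists>B i. A = image_mset Some B + replicate_mset i None"
proof (induction A)
  case (add x A)
  then obtain B i where A: "A = image_mset Some B + replicate_mset i None" by blast
  show ?case
  proof (cases x)
    case None
    then show ?thesis using A by (intro exI[of _ B] exI[of _ "Suc i"]) simp
  next
    case (Some a)
    then show ?thesis using A by (intro exI[of _ "add_mset a B"] exI[of _ i]) simp
  qed
qed auto

lemma count_option_mset:
  "count (image_mset Some B + replicate_mset i None) (Some x) = count B x"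
  "count (image_mset Some B + replicate_mset i None) None = i"
  by (induction B) auto

lemma option_mset_subseteq_iff:
  "image_mset Some B + replicate_mset i None \<subseteq># image_mset Some M + replicate_mset m None
    \<longleftrightarrow> B \<subseteq># M \<and> i \<le> m"
  unfolding subseteq_mset_def by (metis count_option_mset option.exhaust)

text \<open>A divisor of \<open>x^M z^m\<close> is uniquely of the form \<open>x^B z^i\<close>,
  which gives the Cauchy product in \<open>z\<close>.\<close>

lemma aux_coeff_mult:
  "aux_coeff m (F * G) = (\<Sum>i\<le>m. aux_coeff i F * aux_coeff (m - i) G)"
proof (rule series_eqI)
  fix M
  let ?M = "\<lambda>i B. image_mset Some B + replicate_mset i (None :: nat option)"
  have inj: "inj_on (\<lambda>(i, B). ?M i B) ({..m} \<times> {B. B \<subseteq># M})"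
  proof (rule inj_onI; clarify)
    fix i j B C assume eq: "?M i B = ?M j C"
    have "i = j" using eq count_option_mset(2) by metis
    moreover have "B = C"
      using eq by (intro multiset_eqI) (metis count_option_mset(1))
    ultimately show "i = j \<and> B = C" by blast
  qed
  have "{A. A \<subseteq># ?M m M} = (\<lambda>(i, B). ?M i B) ` ({..m} \<times> {B. B \<subseteq># M})"
  proof (intro equalityI subsetI)
    fix A assume A: "A \<in> {A. A \<subseteq># ?M m M}"
    obtain B i where "A = ?M i B" using option_mset_cases by blast
    with A show "A \<in> (\<lambda>(i, B). ?M i B) ` ({..m} \<times> {B. B \<subseteq># M})"
      by (intro image_eqI[of _ _ "(i, B)"]) (auto simp: option_mset_subseteq_iff)
  qed (auto simp: option_mset_subseteq_iff)
  then have "scoeff (aux_coeff m (F * G)) M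
      = (\<Sum>(i, B)\<in>{..m} \<times> {B. B \<subseteq># M}. scoeff F (?M i B) * scoeff G (?M m M - ?M i B))"
    by (simp only: aux_coeff_def scoeff_times scoeff_Series sum.reindex[OF inj])
      (auto intro: sum.cong)
  also have "\<dots> = (\<Sum>(i, B)\<in>{..m} \<times> {B. B \<subseteq># M}. scoeff F (?M i B) * scoeff G (?M (m - i) (M - B)))"
  proof (rule sum.cong[OF refl], clarify)
    fix i B assume *: "i \<le> m" "B \<subseteq># M"
    obtain C where C: "M = B + C" using *(2) by (metis subset_mset.add_diff_inverse)
    obtain k where k: "m = i + k" using *(1) by (metis le_Suc_ex)
    have "?M (i + k) (B + C) = ?M i B + ?M k C"
      by (simp add: multiset_eq_iff)
    then have "?M m M = ?M i B + ?M (m - i) (M - B)"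
      by (simp add: C k)
    then have "?M m M - ?M i B = ?M (m - i) (M - B)"
      by (simp only: add_diff_cancel_left')
    then show "scoeff F (?M i B) * scoeff G (?M m M - ?M i B)
        = scoeff F (?M i B) * scoeff G (?M (m - i) (M - B))" by simp
  qed
  also have "\<dots> = scoeff (\<Sum>i\<le>m. aux_coeff i F * aux_coeff (m - i) G) M"
    by (simp add: aux_coeff_def scoeff_times sum.cartesian_product)
  finally show "scoeff (aux_coeff m (F * G)) M
      = scoeff (\<Sum>i\<le>m. aux_coeff i F * aux_coeff (m - i) G) M" .
qed

lemma aux_coeff_Omega_auxX: "aux_coeff i (Omega auxX) = complete_homogeneous (int i)"
  by (rule series_eqI)
    (auto simp: aux_coeff_def Omega_auxX complete_homogeneous_def count_option_mset
      simp flip: union_iff)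

text \<open>Both sides are convolution inverses of the complete homogeneous functions: the left one
  because \<open>Omega (- auxX)\<close> inverts \<open>Omega auxX\<close>, the right one by the
  alternating relation with \<open>T = UNIV\<close>. As \<open>h_0 = 1\<close>, the inverse is
  determined recursively.\<close>

lemma aux_coeff_Omega_uminus_auxX:
  "aux_coeff j (Omega (- auxX)) = (-1) ^ j * elementary UNIV j"
proof (induction j rule: less_induct)
  case (less m)
  define u where "u = (\<lambda>i. aux_coeff i (Omega (- auxX)))"
  define v where "v = (\<lambda>i. (-1) ^ i * elementary (UNIV :: nat set) i)"
  have one: "aux_coeff m 1 = (if m = 0 then 1 else 0)"
    by (rule series_eqI) (auto simp: aux_coeff_def scoeff_one)
  have "(\<Sum>i\<le>m. u i * complete_homogeneous (int m - int i)) = aux_coeff m 1"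
  proof -
    have "Omega (- auxX) * Omega auxX = 1"
      by (rule Omega_uminus_mult) (simp add: auxX_def)
    then have "aux_coeff m 1 = aux_coeff m (Omega (- auxX) * Omega auxX)" by simp
    then show ?thesis
      unfolding aux_coeff_mult by (simp add: u_def aux_coeff_Omega_auxX of_nat_diff)
  qed
  moreover have "(\<Sum>i\<le>m. v i * complete_homogeneous (int m - int i)) = aux_coeff m 1"
  proof -
    have "card (UNIV \<inter> set_mset M) \<le> m" if "int (size M) = int m" for M :: "nat multiset"
      using that mset_set_set_mset_msubset[of M] size_mset_mono by fastforce
    from sum_elementary_mult_complete_homogeneous[OF this]
    show ?thesis
      unfolding one v_def
      by (auto simp: mult.assoc scoeff_one intro!: series_eqI)
  qed
  ultimately have "(\<Sum>i\<le>m. u i * complete_homogeneous (int m - int i))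
      = (\<Sum>i\<le>m. v i * complete_homogeneous (int m - int i))" by simp
  moreover have "(\<Sum>i<m. u i * complete_homogeneous (int m - int i))
      = (\<Sum>i<m. v i * complete_homogeneous (int m - int i))"
    using less by (simp add: u_def v_def)
  ultimately have "u m = v m"
    by (simp add: lessThan_Suc_atMost[symmetric])
  then show ?case by (simp add: u_def v_def)
qed

section \<open>The ring of symmetric functions\<close>

lemma Lambda_iff:
  "F \<in> Lambda \<longleftrightarrow> symmetric_series F \<and> (\<exists>d. \<forall>M. scoeff F M \<noteq> 0 \<longrightarrow> size M \<le> d)"
proof -
  have "symmetric_series F \<longleftrightarrow>
      (\<forall>\<pi> M. bij \<pi> \<longrightarrow> scoeff F (image_mset \<pi> M) = scoeff F M)"
    by (intro iffI allI impI symmetric_seriesI) (simp_all add: symmetric_seriesD)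
  then show ?thesis by (simp add: Lambda_def)
qed

lemma symmetric_Lambda: "F \<in> Lambda \<Longrightarrow> symmetric_series F"
  by (simp add: Lambda_iff)

lemma Lambda_zero [simp]: "0 \<in> Lambda"
  by (simp add: Lambda_iff)

lemma Lambda_one [simp]: "1 \<in> Lambda"
  by (auto simp: Lambda_iff scoeff_one split: if_splits)

lemma Lambda_scale: "F \<in> Lambda \<Longrightarrow> series_scale c F \<in> Lambda"
  by (auto simp: Lambda_iff symmetric_scale)

lemma Lambda_add:
  assumes "F \<in> Lambda" "G \<in> Lambda"
  shows "F + G \<in> Lambda"
proof -
  obtain d e where d: "\<And>M. scoeff F M \<noteq> 0 \<Longrightarrow> size M \<le> d"
    and e: "\<And>M. scoeff G M \<noteq> 0 \<Longrightarrow> size M \<le> e"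
    using assms by (auto simp: Lambda_iff)
  have "size M \<le> max d e" if "scoeff (F + G) M \<noteq> 0" for M
    using that d[of M] e[of M] by (cases "scoeff F M = 0") auto
  then show ?thesis using assms by (auto simp: Lambda_iff symmetric_add)
qed

lemma Lambda_uminus: "F \<in> Lambda \<Longrightarrow> - F \<in> Lambda"
  by (auto simp: Lambda_iff symmetric_uminus)

lemma Lambda_diff: "F \<in> Lambda \<Longrightarrow> G \<in> Lambda \<Longrightarrow> F - G \<in> Lambda"
  using Lambda_add[of F "- G"] Lambda_uminus[of G] by simp

lemma Lambda_mult:
  assumes "F \<in> Lambda" "G \<in> Lambda"
  shows "F * G \<in> Lambda"
proof -
  obtain d e where d: "\<And>M. scoeff F M \<noteq> 0 \<Longrightarrow> size M \<le> d"
    and e: "\<And>M. scoeff G M \<noteq> 0 \<Longrightarrow> size M \<le> e"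
    using assms by (auto simp: Lambda_iff)
  have "size M \<le> d + e" if "scoeff (F * G) M \<noteq> 0" for M
    using that by (rule scoeff_times_nonzeroE) (use d e in \<open>auto intro: add_mono\<close>)
  then show ?thesis using assms by (auto simp: Lambda_iff symmetric_mult)
qed

lemma Lambda_sum: "(\<And>i. i \<in> I \<Longrightarrow> f i \<in> Lambda) \<Longrightarrow> sum f I \<in> Lambda"
  by (induction I rule: infinite_finite_induct) (auto intro: Lambda_add)

lemma Lambda_prod: "(\<And>i. i \<in> I \<Longrightarrow> f i \<in> Lambda) \<Longrightarrow> prod f I \<in> Lambda"
  by (induction I rule: infinite_finite_induct) (auto intro: Lambda_mult)

lemma Lambda_minus_one_power: "F \<in> Lambda \<Longrightarrow> (-1) ^ j * F \<in> Lambda"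
  by (induction j) (auto intro: Lambda_uminus)

lemma Lambda_signof: "F \<in> Lambda \<Longrightarrow> signof w * F \<in> Lambda"
  by (cases w rule: sign_cases) (auto intro: Lambda_uminus)

lemma Lambda_complete_homogeneous: "complete_homogeneous r \<in> Lambda"
  unfolding Lambda_iff
  by (intro conjI symmetric_complete_homogeneous exI[of _ "nat r"])
    (auto simp: complete_homogeneous_def)

lemma Lambda_elementary: "elementary UNIV j \<in> Lambda"
  unfolding Lambda_iff
  by (intro conjI symmetric_elementary exI[of _ j]) (auto simp: elementary_def)

lemma scoeff_signof_mult: "scoeff (signof w * F) M = signof w * scoeff F M"
  by (cases w rule: sign_cases) auto

section \<open>Straightening of integer vectors\<close>

section \<open>Alternating sums\<close>

text \<open>Both the Jacobi--Trudi determinant and the functional dual to it have the following shape,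
  with \<open>a i = \<nu> ! i - i\<close>.\<close>

definition alternate :: "nat \<Rightarrow> ((nat \<Rightarrow> int) \<Rightarrow> 'b :: comm_ring_1) \<Rightarrow> (nat \<Rightarrow> int) \<Rightarrow> 'b" where
  "alternate n F a = (\<Sum>w | w permutes {0..<n}. signof w * F (\<lambda>i. a i + int (w i)))"

text \<open>The properties that straightening uses, shared by products of complete homogeneous
  functions and by coefficients of a symmetric series. Invariance under permutations yields the sign
  rule, vanishing at negative entries disposes of vectors that are too low, and dropping a final
  zero makes vectors of different lengths comparable.\<close>

definition stable_family :: "(nat \<Rightarrow> (nat \<Rightarrow> int) \<Rightarrow> 'b :: comm_ring_1) \<Rightarrow> bool" where
  "stable_family F \<longleftrightarrow>
    (\<forall>n \<alpha> \<beta>. (\<forall>i<n. \<alpha> i = \<beta> i) \<longrightarrow> F n \<alpha> = F n \<beta>) \<and>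
    (\<forall>n \<alpha> p. p permutes {0..<n} \<longrightarrow> F n (\<alpha> \<circ> p) = F n \<alpha>) \<and>
    (\<forall>n \<alpha>. (\<exists>i<n. \<alpha> i < 0) \<longrightarrow> F n \<alpha> = 0) \<and>
    (\<forall>n \<alpha>. \<alpha> n = 0 \<longrightarrow> F (Suc n) \<alpha> = F n \<alpha>)"

lemma stable_familyD:
  assumes "stable_family F"
  shows "(\<And>i. i < n \<Longrightarrow> \<alpha> i = \<beta> i) \<Longrightarrow> F n \<alpha> = F n \<beta>"
    and "p permutes {0..<n} \<Longrightarrow> F n (\<alpha> \<circ> p) = F n \<alpha>"
    and "i < n \<Longrightarrow> \<alpha> i < 0 \<Longrightarrow> F n \<alpha> = 0"
    and "\<alpha> n = 0 \<Longrightarrow> F (Suc n) \<alpha> = F n \<alpha>"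
proof -
  note F = assms[unfolded stable_family_def]
  show "(\<And>i. i < n \<Longrightarrow> \<alpha> i = \<beta> i) \<Longrightarrow> F n \<alpha> = F n \<beta>"
    using F[THEN conjunct1] by blast
  show "p permutes {0..<n} \<Longrightarrow> F n (\<alpha> \<circ> p) = F n \<alpha>"
    using F[THEN conjunct2, THEN conjunct1] by simp
  show "i < n \<Longrightarrow> \<alpha> i < 0 \<Longrightarrow> F n \<alpha> = 0"
    using F[THEN conjunct2, THEN conjunct2, THEN conjunct1] by blast
  show "\<alpha> n = 0 \<Longrightarrow> F (Suc n) \<alpha> = F n \<alpha>"
    using F[THEN conjunct2, THEN conjunct2, THEN conjunct2] by simp
qed

lemma alternate_cong:
  assumes "stable_family F" "\<And>i. i < n \<Longrightarrow> a i = b i"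
  shows "alternate n (F n) a = alternate n (F n) b"
  unfolding alternate_def
  by (intro sum.cong refl arg_cong2[where f = "(*)"] stable_familyD(1)[OF assms(1)])
    (simp add: assms(2))

text \<open>Replacing \<open>w\<close> by \<open>w \<circ> p\<close> in the sum lets
  \<open>p\<close> act on the whole argument of \<open>F\<close>, where it is absorbed by symmetry;
  its sign remains.\<close>

lemma alternate_permute:
  assumes F: "stable_family F" and p: "p permutes {0..<n}"
  shows "alternate n (F n) (a \<circ> p) = signof p * alternate n (F n) a"
proof -
  have "alternate n (F n) (a \<circ> p)
      = (\<Sum>w | w permutes {0..<n}. signof (w \<circ> p) * F n (\<lambda>i. (a \<circ> p) i + int ((w \<circ> p) i)))"
    unfolding alternate_def by (rule sum_permutations_compose_right[OF p])
  also have "\<dots> = (\<Sum>w | w permutes {0..<n}. signof p * (signof w * F n (\<lambda>i. a i + int (w i))))"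
  proof (rule sum.cong[OF refl])
    fix w assume w: "w \<in> {w. w permutes {0..<n}}"
    have "F n (\<lambda>i. (a \<circ> p) i + int ((w \<circ> p) i)) = F n (\<lambda>i. a i + int (w i))"
      using stable_familyD(2)[OF F p, of "\<lambda>i. a i + int (w i)"] by (simp add: o_def)
    moreover have "signof (w \<circ> p) = signof w * (signof p :: 'a)"
      using w p by (intro signof_compose) auto
    ultimately show "signof (w \<circ> p) * F n (\<lambda>i. (a \<circ> p) i + int ((w \<circ> p) i))
        = signof p * (signof w * F n (\<lambda>i. a i + int (w i)))"
      by (simp add: ac_simps)
  qed
  also have "\<dots> = signof p * alternate n (F n) a"
    by (simp add: alternate_def sum_distrib_left)
  finally show ?thesis .
qed

lemma alternate_eq_0_if_repeated:
  fixes F :: "nat \<Rightarrow> (nat \<Rightarrow> int) \<Rightarrow> rat"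
  assumes F: "stable_family F" and "i < n" "j < n" "i \<noteq> j" "a i = a j"
  shows "alternate n (F n) a = 0"
proof -
  have p: "transpose i j permutes {0..<n}"
    using assms by (intro permutes_swap_id) auto
  have "a \<circ> transpose i j = a"
    using assms(5) by (auto simp: transpose_def)
  then have "alternate n (F n) a = - alternate n (F n) a"
    using alternate_permute[OF F p, of a] assms(4) by (simp add: sign_swap_id)
  then show ?thesis by simp
qed

text \<open>A permutation adds at most \<open>n - 1\<close> to entry \<open>i\<close>, so this entry
  is negative in every term.\<close>

lemma alternate_eq_0_if_negative:
  assumes F: "stable_family F" and i: "i < n" and neg: "a i + int n \<le> 0"
  shows "alternate n (F n) a = 0"
proof -
  have "F n (\<lambda>i. a i + int (w i)) = 0" if "w permutes {0..<n}" for w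
  proof (rule stable_familyD(3)[OF F i])
    have "w i < n" using permutes_in_image[OF that, of i] i by simp
    then show "a i + int (w i) < 0" using neg by simp
  qed
  then show ?thesis by (simp add: alternate_def)
qed

text \<open>The value \<open>- n\<close> at index \<open>n\<close> is that of an appended zero part.
  A permutation contributes only if it adds \<open>n\<close> there, so it fixes \<open>n\<close> and
  the last entry becomes 0.\<close>

lemma alternate_Suc:
  assumes F: "stable_family F" and a: "a n = - int n"
  shows "alternate (Suc n) (F (Suc n)) a = alternate n (F n) a"
  unfolding alternate_def
proof (rule sum.mono_neutral_cong_right)
  show "finite {w. w permutes {0..<Suc n}}" by (simp add: finite_permutations)
  show "{w. w permutes {0..<n}} \<subseteq> {w. w permutes {0..<Suc n}}"
    using permutes_subset[of _ "{0..<n}" "{0..<Suc n}"] by auto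
  show "\<forall>w\<in>{w. w permutes {0..<Suc n}} - {w. w permutes {0..<n}}.
      signof w * F (Suc n) (\<lambda>i. a i + int (w i)) = 0"
  proof
    fix w assume w: "w \<in> {w. w permutes {0..<Suc n}} - {w. w permutes {0..<n}}"
    have "w n \<noteq> n"
    proof
      assume wn: "w n = n"
      have "w permutes {0..<n}"
      proof (rule permutes_superset)
        show "w permutes {0..<Suc n}" using w by simp
        fix x assume "x \<in> {0..<Suc n} - {0..<n}"
        then have "x = n" by auto
        then show "w x = x" using wn by simp
      qed
      then show False using w by simp
    qed
    moreover have "w n < Suc n" using w permutes_in_image[of w "{0..<Suc n}" n] by simp
    ultimately have "a n + int (w n) < 0" using a by simp
    then have "F (Suc n) (\<lambda>i. a i + int (w i)) = 0"
      by (intro stable_familyD(3)[OF F, of n "Suc n"]) simp_all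
    then show "signof w * F (Suc n) (\<lambda>i. a i + int (w i)) = 0" by simp
  qed
  fix w assume "w \<in> {w. w permutes {0..<n}}"
  then have "w n = n" by (simp add: permutes_not_in)
  then have "F (Suc n) (\<lambda>i. a i + int (w i)) = F n (\<lambda>i. a i + int (w i))"
    using a by (intro stable_familyD(4)[OF F]) simp
  then show "signof w * F (Suc n) (\<lambda>i. a i + int (w i))
      = signof w * F n (\<lambda>i. a i + int (w i))" by simp
qed

definition padded :: "int list \<Rightarrow> nat \<Rightarrow> int" where
  "padded \<nu> i = (if i < length \<nu> then \<nu> ! i else 0)"

lemma alternate_padded:
  assumes F: "stable_family F" and "length \<nu> \<le> N"
  shows "alternate N (F N) (\<lambda>i. padded \<nu> i - int i)
    = alternate (length \<nu>) (F (length \<nu>)) (\<lambda>i. padded \<nu> i - int i)"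
  using assms(2)
  by (induction N rule: dec_induct) (simp_all add: alternate_Suc[OF F] padded_def)

lemma strictly_decreasing_arrangement:
  fixes a :: "nat \<Rightarrow> int"
  assumes "inj_on a {0..<n}"
  shows "\<exists>p. p permutes {0..<n} \<and> (\<forall>i j. i < j \<longrightarrow> j < n \<longrightarrow> a (p j) < a (p i))"
proof -
  define l where "l = rev (sorted_list_of_set (a ` {0..<n}))"
  have len: "length l = n"
    using assms by (simp add: l_def card_image)
  have sorted: "l ! j < l ! i" if "i < j" "j < n" for i j
  proof -
    have "sorted_wrt (\<lambda>x y. y < x) l"
      unfolding l_def by (simp add: sorted_wrt_rev)
    then show ?thesis using that len by (simp add: sorted_wrt_iff_nth_less)
  qed
  have "bij_betw ((!) l) {..<length l} (set l)"
    by (rule bij_betw_nth) (simp_all add: l_def)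
  moreover have "set l = a ` {0..<n}"
    by (simp add: l_def)
  ultimately have l: "bij_betw ((!) l) {0..<n} (a ` {0..<n})"
    by (simp only: len atLeast0LessThan)
  define q where "q = inv_into {0..<n} a \<circ> (!) l"
  define p where "p i = (if i < n then q i else i)" for i
  have "bij_betw q {0..<n} {0..<n}"
    unfolding q_def
    by (rule bij_betw_trans[OF l bij_betw_inv_into[OF inj_on_imp_bij_betw[OF assms]]])
  then have "bij_betw p {0..<n} {0..<n}"
    by (rule bij_betw_cong[THEN iffD1, rotated]) (simp add: p_def)
  then have "p permutes {0..<n}"
    by (rule bij_imp_permutes) (simp add: p_def)
  moreover have "a (p i) = l ! i" if "i < n" for i
    using that l by (simp add: p_def q_def f_inv_into_f bij_betw_def)
      (metis atLeast0LessThan f_inv_into_f imageI lessThan_iff)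
  ultimately show ?thesis using sorted by (intro exI[of _ p]) auto
qed

text \<open>Adding the staircase \<open>i\<close> turns strict decrease into weak decrease; cutting
  off the zeros at the end leaves the partition.\<close>

lemma partition_of_strictly_decreasing:
  assumes dec: "\<And>i j. i < j \<Longrightarrow> j < n \<Longrightarrow> a j < (a i :: int)"
    and nonneg: "\<And>i. i < n \<Longrightarrow> 0 < a i + int n"
  shows "\<exists>\<mu>. is_integer_partition \<mu> \<and> length \<mu> \<le> n \<and> (\<forall>i<n. padded \<mu> i - int i = a i)"
proof -
  have gap: "a (i + k) + int k \<le> a i" if "i + k < n" for i k
    using that
  proof (induction k)
    case (Suc k)
    have "a (i + Suc k) < a (i + k)" using Suc.prems by (intro dec) auto
    with Suc show ?case by simp
  qed simp
  define \<nu> where "\<nu> i = a i + int i" for i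
  have mono: "\<nu> j \<le> \<nu> i" if "i \<le> j" "j < n" for i j
    using gap[of i "j - i"] that by (simp add: \<nu>_def)
  have pos: "\<nu> i \<ge> 0" if "i < n" for i
  proof -
    have "i \<le> n - 1" "n - 1 < n" using that by auto
    \<comment> \<open>The lower bound at the last index reads \<open>0 < \<nu> (n - 1) + 1\<close>,
      that is, the smallest part is nonnegative.\<close>
    then have "\<nu> (n - 1) \<le> \<nu> i" "0 < a (n - 1) + int n"
      using mono nonneg by blast+
    then show ?thesis using that by (simp add: \<nu>_def)
  qed
  define \<mu> where "\<mu> = takeWhile (\<lambda>r. r > 0) (map \<nu> [0..<n])"
  have len: "length \<mu> \<le> n"
    using length_takeWhile_le[of "\<lambda>r. r > 0" "map \<nu> [0..<n]"] by (simp add: \<mu>_def)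
  have nth: "\<mu> ! i = \<nu> i" if "i < length \<mu>" for i
    using that len takeWhile_nth[of i "\<lambda>r. r > 0" "map \<nu> [0..<n]"] by (simp add: \<mu>_def)
  have "padded \<mu> i = \<nu> i" if "i < n" for i
  proof (cases "i < length \<mu>")
    case False
    then have "length \<mu> < n" using that by simp
    then have "\<not> \<nu> (length \<mu>) > 0"
      using nth_length_takeWhile[of "\<lambda>r. r > 0" "map \<nu> [0..<n]"] by (simp add: \<mu>_def)
    then have "\<nu> i = 0"
      using mono[of "length \<mu>" i] pos[OF that] False that by simp
    with False show ?thesis by (simp add: padded_def)
  qed (simp add: padded_def nth)
  moreover have "is_integer_partition \<mu>"
    unfolding is_integer_partition_def
  proof
    show "sorted_wrt (\<ge>) \<mu>"
      using len mono by (auto simp: sorted_wrt_iff_nth_less nth)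
    show "\<forall>r\<in>set \<mu>. r > 0" using set_takeWhileD unfolding \<mu>_def by fastforce
  qed
  ultimately show ?thesis using len by (intro exI[of _ \<mu>]) (auto simp: \<nu>_def)
qed

text \<open>A vector with distinct entries can be sorted at the cost of a sign, and then it either
  comes from a partition or has an entry that is too low; a repeated entry gives 0 anyway. Applied
  to a difference of two families, this extends an identity from partitions to all integer
  vectors.\<close>

lemma alternate_eq_0_if_partitions:
  fixes F :: "nat \<Rightarrow> (nat \<Rightarrow> int) \<Rightarrow> rat"
  assumes F: "stable_family F"
    and part: "\<And>\<mu>. is_integer_partition \<mu> \<Longrightarrow>
      alternate (length \<mu>) (F (length \<mu>)) (\<lambda>i. padded \<mu> i - int i) = 0"
  shows "alternate n (F n) a = 0"
proof (cases "inj_on a {0..<n}")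
  case True
  from strictly_decreasing_arrangement[OF this] obtain p where p: "p permutes {0..<n}"
    and "\<forall>i j. i < j \<longrightarrow> j < n \<longrightarrow> a (p j) < a (p i)" by blast
  then have dec: "\<And>i j. i < j \<Longrightarrow> j < n \<Longrightarrow> (a \<circ> p) j < (a \<circ> p) i" by simp
  have "alternate n (F n) (a \<circ> p) = 0"
  proof (cases "\<forall>i<n. 0 < (a \<circ> p) i + int n")
    case True
    then have nonneg: "0 < (a \<circ> p) i + int n" if "i < n" for i
      using that by blast
    obtain \<mu> where \<mu>: "is_integer_partition \<mu>" "length \<mu> \<le> n"
      and eq: "\<And>i. i < n \<Longrightarrow> padded \<mu> i - int i = (a \<circ> p) i"
      using partition_of_strictly_decreasing[of n "a \<circ> p", OF dec nonneg] by blast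
    have "alternate n (F n) (a \<circ> p) = alternate n (F n) (\<lambda>i. padded \<mu> i - int i)"
      by (rule alternate_cong[OF F]) (simp only: eq)
    also have "\<dots> = 0"
      using alternate_padded[OF F \<mu>(2)] part[OF \<mu>(1)] by simp
    finally show ?thesis .
  next
    case False
    then obtain i where "i < n" "(a \<circ> p) i + int n \<le> 0" by (auto simp: not_less)
    then show ?thesis by (rule alternate_eq_0_if_negative[OF F])
  qed
  then show ?thesis
    using alternate_permute[OF F p, of a] by simp
next
  case False
  then obtain i j where "i < n" "j < n" "i \<noteq> j" "a i = a j"
    by (auto simp: inj_on_def)
  then show ?thesis by (rule alternate_eq_0_if_repeated[OF F])
qed

section \<open>Duality between Jacobi-Trudi determinants and alternating sums of
  coefficients\<close>

section \<open>Schur functions and their dual functionals\<close>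

definition complete_product :: "nat \<Rightarrow> (nat \<Rightarrow> int) \<Rightarrow> nat series" where
  "complete_product n \<alpha> = (\<Prod>i\<in>{0..<n}. complete_homogeneous (\<alpha> i))"

definition exponent_mset :: "nat \<Rightarrow> (nat \<Rightarrow> int) \<Rightarrow> nat multiset" where
  "exponent_mset n \<alpha> = (\<Sum>i\<in>{0..<n}. replicate_mset (nat (\<alpha> i)) i)"

text \<open>The value 0 at a negative exponent is essential: \<open>nat\<close> would clip the
  exponent to 0 and yield the coefficient of another monomial.\<close>

definition vector_coeff :: "nat series \<Rightarrow> nat \<Rightarrow> (nat \<Rightarrow> int) \<Rightarrow> rat" where
  "vector_coeff Q n \<alpha> = (if \<forall>i<n. \<alpha> i \<ge> 0 then scoeff Q (exponent_mset n \<alpha>) else 0)"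

lemma count_exponent_mset: "count (exponent_mset n \<alpha>) k = (if k < n then nat (\<alpha> k) else 0)"
  by (simp add: exponent_mset_def count_sum)

lemma exponent_mset_permute:
  assumes "p permutes {0..<n}"
  shows "image_mset p (exponent_mset n (\<alpha> \<circ> p)) = exponent_mset n \<alpha>"
proof -
  let ?g = "\<lambda>i. replicate_mset (nat (\<alpha> i)) i"
  have "image_mset p (\<Sum>i\<in>I. replicate_mset (nat (\<alpha> (p i))) i) = sum (?g \<circ> p) I"
    if "finite I" for I
    using that by (induction I rule: finite_induct) simp_all
  then have "image_mset p (exponent_mset n (\<alpha> \<circ> p)) = sum (?g \<circ> p) {0..<n}"
    by (simp add: exponent_mset_def)
  also have "\<dots> = sum ?g {0..<n}"
    by (rule sum.permute[OF assms, symmetric])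
  finally show ?thesis by (simp only: exponent_mset_def)
qed

lemma stable_complete_product: "stable_family complete_product"
  unfolding stable_family_def
proof (intro conjI allI impI)
  fix n :: nat and \<alpha> :: "nat \<Rightarrow> int" and p
  assume "p permutes {0..<n}"
  from prod.permute[OF this, of "\<lambda>i. complete_homogeneous (\<alpha> i)"]
  show "complete_product n (\<alpha> \<circ> p) = complete_product n \<alpha>"
    by (simp add: complete_product_def o_def)
next
  fix n and \<alpha> :: "nat \<Rightarrow> int"
  assume "\<exists>i<n. \<alpha> i < 0"
  then obtain i where i: "i < n" "\<alpha> i < 0" by blast
  then show "complete_product n \<alpha> = 0"
    unfolding complete_product_def by (intro prod_zero bexI[of _ i]) simp_all
qed (simp_all add: complete_product_def)

lemma stable_vector_coeff:
  assumes "symmetric_series Q"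
  shows "stable_family (vector_coeff Q)"
  unfolding stable_family_def
proof (intro conjI allI impI)
  fix n :: nat and \<alpha> :: "nat \<Rightarrow> int" and p
  assume p: "p permutes {0..<n}"
  have "scoeff Q (exponent_mset n (\<alpha> \<circ> p)) = scoeff Q (exponent_mset n \<alpha>)"
    using symmetric_seriesD[OF assms permutes_bij[OF p]] exponent_mset_permute[OF p, of \<alpha>] by metis
  moreover have "(\<forall>i<n. (\<alpha> \<circ> p) i \<ge> 0) \<longleftrightarrow> (\<forall>i<n. \<alpha> i \<ge> 0)"
  proof -
    have "(\<forall>x\<in>p ` {0..<n}. \<alpha> x \<ge> 0) \<longleftrightarrow> (\<forall>x\<in>{0..<n}. \<alpha> x \<ge> 0)"
      by (simp only: permutes_image[OF p])
    then have "(\<forall>x\<in>{0..<n}. \<alpha> (p x) \<ge> 0) \<longleftrightarrow> (\<forall>x\<in>{0..<n}. \<alpha> x \<ge> 0)"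
      by (simp only: ball_simps)
    then show ?thesis by (simp only: o_def Ball_def atLeastLessThan_iff le0 simp_thms)
  qed
  ultimately show "vector_coeff Q n (\<alpha> \<circ> p) = vector_coeff Q n \<alpha>"
    unfolding vector_coeff_def by presburger
next
  fix n and \<alpha> \<beta> :: "nat \<Rightarrow> int"
  assume "\<forall>i<n. \<alpha> i = \<beta> i"
  then show "vector_coeff Q n \<alpha> = vector_coeff Q n \<beta>"
    by (auto simp: vector_coeff_def exponent_mset_def)
next
  fix n and \<alpha> :: "nat \<Rightarrow> int"
  assume "\<alpha> n = 0"
  then show "vector_coeff Q (Suc n) \<alpha> = vector_coeff Q n \<alpha>"
    by (auto simp: vector_coeff_def exponent_mset_def less_Suc_eq)
next
  fix n and \<alpha> :: "nat \<Rightarrow> int"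
  assume "\<exists>i<n. \<alpha> i < 0"
  then show "vector_coeff Q n \<alpha> = 0"
    by (auto simp: vector_coeff_def)
qed

lemma schur_eq_alternate:
  "schur \<nu> = alternate (length \<nu>) (complete_product (length \<nu>)) (\<lambda>i. padded \<nu> i - int i)"
  unfolding schur_def alternate_def complete_product_def
  by (subst det_def'[of _ "length \<nu>"])
    (auto intro!: sum.cong prod.cong simp: padded_def)

text \<open>When all exponents of \<open>\<nu>\<close> plus the staircase are nonnegative, this is
  the coefficient at that exponent in \<open>Q\<close> times the Vandermonde determinant. It is
  meaningful without a basis or a degree bound.\<close>

definition schur_dual :: "int list \<Rightarrow> nat series \<Rightarrow> rat" where
  "schur_dual \<nu> Q = alternate (length \<nu>) (vector_coeff Q (length \<nu>)) (\<lambda>i. padded \<nu> i - int i)"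

lemma schur_eq_alternate_padded:
  "length \<nu> \<le> N \<Longrightarrow> schur \<nu> = alternate N (complete_product N) (\<lambda>i. padded \<nu> i - int i)"
  unfolding schur_eq_alternate by (rule alternate_padded[OF stable_complete_product, symmetric])

lemma schur_dual_eq_alternate_padded:
  "symmetric_series Q \<Longrightarrow> length \<nu> \<le> N \<Longrightarrow>
    schur_dual \<nu> Q = alternate N (vector_coeff Q N) (\<lambda>i. padded \<nu> i - int i)"
  unfolding schur_dual_def by (rule alternate_padded[OF stable_vector_coeff, symmetric])

lemma Lambda_complete_product: "complete_product n \<alpha> \<in> Lambda"
  unfolding complete_product_def by (intro Lambda_prod Lambda_complete_homogeneous)

lemma Lambda_schur: "schur \<nu> \<in> Lambda"
  unfolding schur_eq_alternate alternate_def
  by (intro Lambda_sum Lambda_signof Lambda_complete_product)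

section \<open>The bialternant formula\<close>

definition monomial :: "'v multiset \<Rightarrow> 'v series" where
  "monomial A = Series (\<lambda>M. if M = A then 1 else 0)"

lemma scoeff_monomial: "scoeff (monomial A) M = (if M = A then 1 else 0)"
  by (simp add: monomial_def)

lemma scoeff_mult_monomial:
  "scoeff (F * monomial A) M = (if A \<subseteq># M then scoeff F (M - A) else 0)"
proof -
  have "scoeff (monomial A * F) M
      = (\<Sum>B | B \<subseteq># M. if B = A then scoeff F (M - A) else 0)"
    unfolding scoeff_times by (rule sum.cong) (auto simp: scoeff_monomial)
  also have "\<dots> = (if A \<subseteq># M then scoeff F (M - A) else 0)"
    by (subst sum.delta[OF finite_submultisets]) simp
  finally show ?thesis by (simp add: mult.commute)
qed

lemma monomial_mult: "monomial A * monomial B = monomial (A + B)"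
  by (rule series_eqI) (auto simp: scoeff_mult_monomial scoeff_monomial)

lemma monomial_empty: "monomial {#} = 1"
  by (rule series_eqI) (simp add: scoeff_monomial scoeff_one)

lemma prod_monomial: "(\<Prod>i\<in>I. monomial (f i)) = monomial (\<Sum>i\<in>I. f i)"
  by (induction I rule: infinite_finite_induct) (simp_all add: monomial_empty monomial_mult)

text \<open>Substitution of 0 for all but the first \<open>N\<close> indeterminates. The bialternant
  formula lives in finitely many indeterminates; being a ring homomorphism, the substitution
  commutes with determinants.\<close>

definition restrict_series :: "nat \<Rightarrow> nat series \<Rightarrow> nat series" where
  "restrict_series N F = Series (\<lambda>M. if set_mset M \<subseteq> {0..<N} then scoeff F M else 0)"

lemma scoeff_restrict:
  "scoeff (restrict_series N F) M = (if set_mset M \<subseteq> {0..<N} then scoeff F M else 0)"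
  by (simp add: restrict_series_def)

lemma restrict_series_mult:
  "restrict_series N (F * G) = restrict_series N F * restrict_series N G"
proof (rule series_eqI)
  fix M
  show "scoeff (restrict_series N (F * G)) M
      = scoeff (restrict_series N F * restrict_series N G) M"
  proof (cases "set_mset M \<subseteq> {0..<N}")
    case True
    have "set_mset A \<subseteq> {0..<N}" "set_mset (M - A) \<subseteq> {0..<N}" if "A \<subseteq># M" for A
      using that True set_mset_mono[OF that] set_mset_mono[OF diff_subset_eq_self[of M A]] by blast+
    then show ?thesis
      unfolding scoeff_restrict scoeff_times using True by (auto intro!: sum.cong)
  next
    case False
    have "\<not> set_mset A \<subseteq> {0..<N} \<or> \<not> set_mset (M - A) \<subseteq> {0..<N}" if "A \<subseteq># M" for A
      using that False by (metis le_sup_iff set_mset_union subset_mset.add_diff_inverse)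
    then have "(\<Sum>A | A \<subseteq># M. scoeff (restrict_series N F) A * scoeff (restrict_series N G) (M - A)) = 0"
      unfolding scoeff_restrict by (intro sum.neutral) auto
    then show ?thesis
      using False by (simp only: scoeff_times scoeff_restrict if_False)
  qed
qed

interpretation restrict_series: comm_ring_hom "restrict_series N" for N
  by unfold_locales
    (auto intro: series_eqI simp: restrict_series_mult scoeff_restrict scoeff_one)

lemma set_exponent_mset: "set_mset (exponent_mset N \<alpha>) \<subseteq> {0..<N}"
  by (auto simp: count_exponent_mset simp flip: count_greater_zero_iff split: if_splits)

text \<open>After restriction \<open>x_k\<close> is the only indeterminate outside the set, so its
  complete homogeneous function of degree \<open>m\<close> is a power. The summation bound
  \<open>N - 1\<close> is the size of the set.\<close>

lemma restrict_sum_elementary_mult_complete_homogeneous: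
  assumes k: "k < N" and m: "m \<ge> 0"
  shows "restrict_series N
      (\<Sum>c\<le>N - 1. (-1) ^ c * (elementary ({0..<N} - {k}) c * complete_homogeneous (m - int c)))
    = monomial (replicate_mset (nat m) k)"
proof -
  let ?T = "{0..<N} - {k}"
  have "card (?T \<inter> A) \<le> N - 1" for A
    using card_mono[of ?T "?T \<inter> A"] k by simp
  then have eq: "(\<Sum>c\<le>N - 1. (-1) ^ c * (elementary ?T c * complete_homogeneous (m - int c)))
      = Series (\<lambda>M. if int (size M) = m \<and> ?T \<inter> set_mset M = {} then 1 else 0)"
    by (rule sum_elementary_mult_complete_homogeneous)
  have iff: "(set_mset M \<subseteq> {0..<N} \<and> int (size M) = m \<and> ?T \<inter> set_mset M = {})
      \<longleftrightarrow> M = replicate_mset (nat m) k" for M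
  proof
    assume M: "set_mset M \<subseteq> {0..<N} \<and> int (size M) = m \<and> ?T \<inter> set_mset M = {}"
    then have "set_mset M \<subseteq> {k}" by blast
    then show "M = replicate_mset (nat m) k"
      using set_mset_subset_singletonD M by fastforce
  next
    assume "M = replicate_mset (nat m) k"
    then show "set_mset M \<subseteq> {0..<N} \<and> int (size M) = m \<and> ?T \<inter> set_mset M = {}"
      using k m by auto
  qed
  show ?thesis
    unfolding eq
    by (rule series_eqI) (simp only: scoeff_restrict scoeff_monomial scoeff_Series if_if_eq_conj
        iff[symmetric])
qed

definition complete_matrix :: "nat \<Rightarrow> (nat \<Rightarrow> int) \<Rightarrow> nat series mat" where
  "complete_matrix N a = mat N N (\<lambda>(i, c). complete_homogeneous (a i + int c))"

text \<open>Column \<open>k\<close> lists the coefficients of the product of the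
  \<open>1 - t x_l\<close> over \<open>l \<noteq> k\<close>, highest power of \<open>t\<close> on
  top. This is the factor that turns the matrix of complete homogeneous functions into one of
  powers.\<close>

definition elementary_matrix :: "nat \<Rightarrow> nat series mat" where
  "elementary_matrix N =
    mat N N (\<lambda>(c, k). (-1) ^ (N - 1 - c) * elementary ({0..<N} - {k}) (N - 1 - c))"

text \<open>The alternant: for \<open>a i = \<nu> ! i - i\<close> the exponent is
  \<open>\<nu> ! i + (N - 1 - i)\<close>, and for \<open>a i = - i\<close> the determinant is that
  of Vandermonde.\<close>

definition power_matrix :: "nat \<Rightarrow> (nat \<Rightarrow> int) \<Rightarrow> nat series mat" where
  "power_matrix N a = mat N N (\<lambda>(i, k). monomial (replicate_mset (nat (a i + int N - 1)) k))"

lemma restrict_complete_mult_elementary_matrix: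
  assumes a: "\<And>i. i < N \<Longrightarrow> 0 < a i + int N"
  shows "map_mat (restrict_series N) (complete_matrix N a * elementary_matrix N) = power_matrix N a"
proof (rule eq_matI)
  fix i k assume "i < dim_row (power_matrix N a)" "k < dim_col (power_matrix N a)"
  then have ik: "i < N" "k < N" by (simp_all add: power_matrix_def)
  let ?m = "a i + int N - 1"
  let ?T = "{0..<N} - {k}"
  have "(complete_matrix N a * elementary_matrix N) $$ (i, k)
      = (\<Sum>c = 0..<N. complete_homogeneous (a i + int c)
          * ((-1) ^ (N - 1 - c) * elementary ?T (N - 1 - c)))"
    using ik by (simp add: complete_matrix_def elementary_matrix_def scalar_prod_def)
  also have "\<dots> = (\<Sum>c\<le>N - 1. (-1) ^ c * (elementary ?T c * complete_homogeneous (?m - int c)))"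
    by (rule sum.reindex_bij_witness[of _ "\<lambda>c. N - 1 - c" "\<lambda>c. N - 1 - c"])
      (use ik in \<open>auto simp: ac_simps of_nat_diff algebra_simps\<close>)
  finally have "restrict_series N ((complete_matrix N a * elementary_matrix N) $$ (i, k))
      = monomial (replicate_mset (nat ?m) k)"
    using restrict_sum_elementary_mult_complete_homogeneous[OF ik(2), of ?m] a[OF ik(1)] by simp
  then show "map_mat (restrict_series N) (complete_matrix N a * elementary_matrix N) $$ (i, k)
      = power_matrix N a $$ (i, k)"
    using ik by (simp add: power_matrix_def complete_matrix_def elementary_matrix_def)
qed (simp_all add: power_matrix_def complete_matrix_def elementary_matrix_def)

lemma det_complete_matrix: "det (complete_matrix N a) = alternate N (complete_product N) a"
  unfolding complete_matrix_def alternate_def complete_product_def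
  by (subst det_def'[of _ N]) (auto intro!: sum.cong prod.cong)

text \<open>The sum is reindexed by inverse permutations, so that they permute the exponents instead
  of the indeterminates.\<close>

lemma det_power_matrix:
  "det (power_matrix N a)
    = (\<Sum>w | w permutes {0..<N}. signof w * monomial (exponent_mset N (\<lambda>i. a (w i) + int N - 1)))"
proof -
  let ?\<alpha> = "\<lambda>i. a i + int N - 1"
  have "det (power_matrix N a) = (\<Sum>w | w permutes {0..<N}.
      signof w * (\<Prod>i = 0..<N. monomial (replicate_mset (nat (?\<alpha> i)) (w i))))"
    unfolding power_matrix_def by (subst det_def'[of _ N]) (auto intro!: sum.cong prod.cong)
  also have "\<dots> = (\<Sum>w | w permutes {0..<N}. signof w * monomial (image_mset w (exponent_mset N ?\<alpha>)))"
  proof (intro sum.cong refl arg_cong2[where f = "(*)"])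
    fix w :: "nat \<Rightarrow> nat"
    have "image_mset w (\<Sum>i\<in>I. replicate_mset (nat (?\<alpha> i)) i)
        = (\<Sum>i\<in>I. replicate_mset (nat (?\<alpha> i)) (w i))" if "finite I" for I
      using that by (induction I rule: finite_induct) simp_all
    then show "(\<Prod>i = 0..<N. monomial (replicate_mset (nat (?\<alpha> i)) (w i)))
        = monomial (image_mset w (exponent_mset N ?\<alpha>))"
      by (simp add: prod_monomial exponent_mset_def)
  qed
  also have "\<dots> = (\<Sum>w | w permutes {0..<N}. signof (inv_into UNIV w)
      * monomial (image_mset (inv_into UNIV w) (exponent_mset N ?\<alpha>)))"
    by (rule sum_permutations_inverse)
  also have "\<dots> = (\<Sum>w | w permutes {0..<N}.
      signof w * monomial (exponent_mset N (\<lambda>i. a (w i) + int N - 1)))"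
  proof (rule sum.cong[OF refl])
    fix w assume "w \<in> {w. w permutes {0..<N}}"
    then have w: "w permutes {0..<N}" by simp
    have "image_mset (inv_into UNIV w) (exponent_mset N ((?\<alpha> \<circ> w) \<circ> inv_into UNIV w))
        = exponent_mset N (?\<alpha> \<circ> w)"
      by (rule exponent_mset_permute[OF permutes_inv[OF w]])
    moreover have "(?\<alpha> \<circ> w) \<circ> inv_into UNIV w = ?\<alpha>"
      by (simp add: comp_assoc permutes_inv_o[OF w])
    moreover have "signof (inv_into UNIV w) = (signof w :: nat series)"
      by (rule signof_inv[OF _ w]) simp
    ultimately show "signof (inv_into UNIV w)
        * monomial (image_mset (inv_into UNIV w) (exponent_mset N ?\<alpha>))
        = signof w * monomial (exponent_mset N (\<lambda>i. a (w i) + int N - 1))"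
      by (simp add: o_def)
  qed
  finally show ?thesis .
qed

lemma schur_Nil [simp]: "schur [] = 1"
  by (simp add: schur_def)

text \<open>The determinant of the elementary matrix does not depend on \<open>a\<close>. The choice
  \<open>a i = - i\<close>, where the Jacobi-Trudi determinant is 1, identifies its restriction with
  the Vandermonde determinant, so the formula is obtained without division.\<close>

lemma bialternant:
  assumes a: "\<And>i. i < N \<Longrightarrow> 0 < a i + int N"
  shows "restrict_series N (alternate N (complete_product N) a)
      * det (power_matrix N (\<lambda>i. - int i)) = det (power_matrix N a)"
proof -
  have eq: "restrict_series N (alternate N (complete_product N) b)
      * restrict_series N (det (elementary_matrix N)) = det (power_matrix N b)"
    if "\<And>i. i < N \<Longrightarrow> 0 < b i + int N" for b
  proof -
    have "det (power_matrix N b)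
        = restrict_series N (det (complete_matrix N b * elementary_matrix N))"
      unfolding restrict_series.hom_det[symmetric]
      by (subst restrict_complete_mult_elementary_matrix[OF that]) simp_all
    also have "\<dots> = restrict_series N (det (complete_matrix N b) * det (elementary_matrix N))"
      by (subst det_mult[of _ N]) (simp_all add: complete_matrix_def elementary_matrix_def)
    finally show ?thesis by (simp only: restrict_series_mult det_complete_matrix)
  qed
  have "alternate N (complete_product N) (\<lambda>i. - int i) = 1"
    using schur_eq_alternate_padded[of "[]" N] by (simp add: padded_def)
  then have "restrict_series N (det (elementary_matrix N)) = det (power_matrix N (\<lambda>i. - int i))"
    using eq[of "\<lambda>i. - int i"] by simp
  then show ?thesis using eq[OF a] by simp
qed

section \<open>Orthonormality\<close>

text \<open>The Vandermonde term of \<open>w\<close> has exponent \<open>N - 1 - w i\<close> at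
  \<open>x_i\<close>. Removing it from \<open>b i + N - 1\<close> leaves \<open>b i + w i\<close>,
  and it divides exactly when all these are nonnegative, which is the case distinction in
  \<open>vector_coeff\<close>.\<close>

lemma scoeff_mult_det_power_matrix:
  assumes b: "\<And>i. i < N \<Longrightarrow> 0 < b i + int N"
  shows "scoeff (restrict_series N Q * det (power_matrix N (\<lambda>i. - int i)))
      (exponent_mset N (\<lambda>i. b i + int N - 1))
    = alternate N (vector_coeff Q N) b"
proof -
  let ?M = "exponent_mset N (\<lambda>i. b i + int N - 1)"
  let ?W = "\<lambda>w. exponent_mset N (\<lambda>i. - int (w i) + int N - 1)"
  have "scoeff (restrict_series N Q * monomial (?W w)) ?M
      = vector_coeff Q N (\<lambda>i. b i + int (w i))" if w: "w permutes {0..<N}" for w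
  proof -
    have wi: "w i < N" if "i < N" for i
      using permutes_in_image[OF w, of i] that by simp
    have "?W w \<subseteq># ?M \<longleftrightarrow> (\<forall>i<N. 0 \<le> b i + int (w i))"
    proof -
      have "nat (- int (w i) + int N - 1) \<le> nat (b i + int N - 1) \<longleftrightarrow> 0 \<le> b i + int (w i)"
        if "i < N" for i
        using b[OF that] wi[OF that] by linarith
      then show ?thesis by (auto simp: subseteq_mset_def count_exponent_mset)
    qed
    moreover have "?M - ?W w = exponent_mset N (\<lambda>i. b i + int (w i))"
    proof (rule multiset_eqI)
      fix i
      have "nat (b i + int N - 1) - nat (- int (w i) + int N - 1) = nat (b i + int (w i))"
        if "i < N"
        using b[OF that] wi[OF that] by linarith
      then show "count (?M - ?W w) i = count (exponent_mset N (\<lambda>i. b i + int (w i))) i"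
        by (simp add: count_exponent_mset)
    qed
    ultimately show ?thesis
      using set_exponent_mset[of N "\<lambda>i. b i + int (w i)"]
      by (simp only: scoeff_mult_monomial scoeff_restrict vector_coeff_def if_True)
  qed
  then show ?thesis
    unfolding det_power_matrix alternate_def sum_distrib_left scoeff_sum
    by (intro sum.cong refl)
      (simp add: scoeff_signof_mult mult.left_commute[of "restrict_series N Q"])
qed

lemma strictly_increasing_permutation:
  fixes N :: nat
  assumes w: "w permutes {0..<N}" and mono: "\<And>i j. i < j \<Longrightarrow> j < N \<Longrightarrow> w i < w j"
  shows "w = id"
proof -
  have "w i = i" if "i < N" for i
    using that
  proof (induction i rule: less_induct)
    case (less i)
    have "i \<in> w ` {0..<N}" unfolding permutes_image[OF w] using less.prems by simp
    then obtain k where k: "k < N" "w k = i" by (metis atLeastLessThan_iff imageE)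
    have "\<not> k < i" using less.IH[of k] k by linarith
    moreover have "\<not> i < k"
    proof
      assume "i < k"
      then have "w i < i" using mono[of i k] k by simp
      then have "w (w i) = w i" using less.IH[of "w i"] less.prems by simp
      then have "w i = i" using permutes_inj[OF w] by (simp add: inj_eq)
      then show False using \<open>w i < i\<close> by simp
    qed
    ultimately show ?case using k by simp
  qed
  moreover have "w i = i" if "\<not> i < N" for i
    using permutes_not_in[OF w, of i] that by simp
  ultimately show ?thesis by (metis eq_id_iff)
qed

text \<open>The terms of the alternant carry rearrangements of the same distinct exponents, and only
  the identity leaves them decreasing.\<close>

lemma scoeff_det_power_matrix:
  assumes a: "\<And>i j. i < j \<Longrightarrow> j < N \<Longrightarrow> a j < a i" "\<And>i. i < N \<Longrightarrow> 0 < a i + int N"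
    and b: "\<And>i j. i < j \<Longrightarrow> j < N \<Longrightarrow> b j < b i" "\<And>i. i < N \<Longrightarrow> 0 < b i + int N"
  shows "scoeff (det (power_matrix N a)) (exponent_mset N (\<lambda>i. b i + int N - 1))
    = (if \<forall>i<N. a i = b i then 1 else 0)"
proof -
  let ?M = "exponent_mset N (\<lambda>i. b i + int N - 1)"
  have iff: "?M = exponent_mset N (\<lambda>i. a (w i) + int N - 1) \<longleftrightarrow> w = id \<and> (\<forall>i<N. a i = b i)"
    if w: "w permutes {0..<N}" for w
  proof
    assume eq: "?M = exponent_mset N (\<lambda>i. a (w i) + int N - 1)"
    have wi: "w i < N" if "i < N" for i
      using permutes_in_image[OF w, of i] that by simp
    have ba: "b i = a (w i)" if "i < N" for i
      using arg_cong[OF eq, of "\<lambda>M. count M i"] that b(2)[OF that] a(2)[OF wi[OF that]]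
      by (simp add: count_exponent_mset)
    have "w i < w j" if ij: "i < j" "j < N" for i j
    proof (rule ccontr)
      assume "\<not> w i < w j"
      moreover have "w i \<noteq> w j" using permutes_inj[OF w] ij by (simp add: inj_eq)
      ultimately have "a (w i) < a (w j)" using ij wi by (intro a(1)) auto
      then show False using b(1)[OF ij] ba ij by simp
    qed
    then have "w = id" by (rule strictly_increasing_permutation[OF w])
    then show "w = id \<and> (\<forall>i<N. a i = b i)" using ba by simp
  next
    assume "w = id \<and> (\<forall>i<N. a i = b i)"
    then show "?M = exponent_mset N (\<lambda>i. a (w i) + int N - 1)"
      by (simp add: exponent_mset_def)
  qed
  have "scoeff (det (power_matrix N a)) ?M
      = (\<Sum>w | w permutes {0..<N}. if w = id then if \<forall>i<N. a i = b i then 1 else 0 else 0)"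
    unfolding det_power_matrix scoeff_sum scoeff_signof_mult
    by (intro sum.cong refl) (auto simp: scoeff_monomial iff)
  also have "\<dots> = (if \<forall>i<N. a i = b i then 1 else 0)"
    by (subst sum.delta) (simp_all add: finite_permutations permutes_id)
  finally show ?thesis .
qed

lemma padded_partition:
  assumes "is_integer_partition \<mu>"
  shows "padded \<mu> i \<ge> 0" "i < j \<Longrightarrow> padded \<mu> j \<le> padded \<mu> i"
  using assms unfolding is_integer_partition_def padded_def
  by (auto simp: sorted_wrt_iff_nth_less intro: less_imp_le)

lemma padded_partition_eqD:
  assumes \<mu>: "is_integer_partition \<mu>" "length \<mu> \<le> N"
    and \<nu>: "is_integer_partition \<nu>" "length \<nu> \<le> N"
    and eq: "\<And>i. i < N \<Longrightarrow> padded \<mu> i = padded \<nu> i"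
  shows "\<mu> = \<nu>"
proof -
  have pos: "i < length \<kappa> \<longleftrightarrow> padded \<kappa> i > 0" if "is_integer_partition \<kappa>" for \<kappa> i
    using that by (auto simp: is_integer_partition_def padded_def)
  have iff: "i < length \<mu> \<longleftrightarrow> i < length \<nu>" for i
  proof (cases "i < N")
    case True
    then show ?thesis using pos[OF \<mu>(1)] pos[OF \<nu>(1)] eq by simp
  qed (use \<mu>(2) \<nu>(2) in auto)
  then have "length \<mu> = length \<nu>" by (metis linorder_neqE_nat less_irrefl)
  moreover have "\<mu> ! i = \<nu> ! i" if "i < length \<mu>" for i
    using that eq[of i] iff[of i] \<mu>(2) by (simp add: padded_def)
  ultimately show ?thesis by (intro nth_equalityI) auto
qed

lemma schur_dual_schur:
  assumes \<mu>: "is_integer_partition \<mu>" and \<nu>: "is_integer_partition \<nu>"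
  shows "schur_dual \<mu> (schur \<nu>) = (if \<mu> = \<nu> then 1 else 0)"
proof -
  define N where "N = max (length \<mu>) (length \<nu>)"
  let ?a = "\<lambda>\<kappa> i. padded \<kappa> i - int i"
  have dec: "?a \<kappa> j < ?a \<kappa> i" if "is_integer_partition \<kappa>" "i < j" for \<kappa> i j
    using padded_partition(2)[OF that] that(2) by simp
  have pos: "0 < ?a \<kappa> i + int N" if "is_integer_partition \<kappa>" "i < N" for \<kappa> i
    using padded_partition(1)[OF that(1), of i] that(2) by linarith
  have len: "length \<mu> \<le> N" "length \<nu> \<le> N" by (simp_all add: N_def)
  have "schur_dual \<mu> (schur \<nu>) = alternate N (vector_coeff (schur \<nu>) N) (?a \<mu>)"
    by (rule schur_dual_eq_alternate_padded[OF symmetric_Lambda[OF Lambda_schur] len(1)])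
  also have "\<dots> = scoeff (restrict_series N (schur \<nu>) * det (power_matrix N (\<lambda>i. - int i)))
      (exponent_mset N (\<lambda>i. ?a \<mu> i + int N - 1))"
    by (rule scoeff_mult_det_power_matrix[symmetric]) (rule pos[OF \<mu>])
  also have "\<dots> = scoeff (det (power_matrix N (?a \<nu>))) (exponent_mset N (\<lambda>i. ?a \<mu> i + int N - 1))"
    unfolding schur_eq_alternate_padded[OF len(2)] by (subst bialternant) (use pos[OF \<nu>] in simp_all)
  also have "\<dots> = (if \<forall>i<N. ?a \<nu> i = ?a \<mu> i then 1 else 0)"
    by (rule scoeff_det_power_matrix) (use dec pos \<mu> \<nu> in blast)+
  also have "(\<forall>i<N. ?a \<nu> i = ?a \<mu> i) \<longleftrightarrow> \<mu> = \<nu>"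
    using padded_partition_eqD[OF \<mu> len(1) \<nu> len(2)] by auto
  finally show ?thesis .
qed

section \<open>Completeness of the Schur functions in \<open>Lambda\<close>\<close>

section \<open>The Schur basis\<close>

text \<open>Used to move a monomial into the first \<open>N\<close> indeterminates. A bijection from
  \<open>A\<close> to an initial segment is completed within the union of both sets and is the
  identity elsewhere.\<close>

lemma ex_bij_into_initial_segment:
  assumes A: "finite A" "card A \<le> N"
  shows "\<exists>\<pi> :: nat \<Rightarrow> nat. bij \<pi> \<and> \<pi> ` A \<subseteq> {0..<N}"
proof -
  let ?B = "{0..<card A}"
  let ?U = "A \<union> ?B"
  obtain f where f: "bij_betw f A ?B"
    using A(1) finite_same_card_bij[of A ?B] by auto
  have "card (?U - A) = card (?U - ?B)"
    using A(1) by (simp add: card_Diff_subset)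
  then obtain g where g: "bij_betw g (?U - A) (?U - ?B)"
    using A(1) finite_same_card_bij[of "?U - A" "?U - ?B"] by auto
  have h: "bij_betw (\<lambda>x. if x \<in> A then f x else g x) (A \<union> (?U - A)) (?B \<union> (?U - ?B))"
    by (rule bij_betw_disjoint_Un[OF f g]) auto
  define \<pi> where "\<pi> x = (if x \<in> A \<union> (?U - A) then if x \<in> A then f x else g x else x)" for x
  have "bij_betw \<pi> ((A \<union> (?U - A)) \<union> - ?U) ((?B \<union> (?U - ?B)) \<union> - ?U)"
    unfolding \<pi>_def by (rule bij_betw_disjoint_Un[OF h, of "\<lambda>x. x"]) (auto simp: bij_betw_def)
  moreover have "(A \<union> (?U - A)) \<union> - ?U = UNIV" "(?B \<union> (?U - ?B)) \<union> - ?U = UNIV" by auto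
  ultimately have "bij \<pi>" by simp
  moreover have "\<pi> ` A = f ` A" by (auto simp: \<pi>_def)
  then have "\<pi> ` A \<subseteq> {0..<N}"
    using f A(2) by (auto simp: bij_betw_def)
  ultimately show ?thesis by blast
qed

lemma exponent_mset_count:
  assumes "set_mset M \<subseteq> {0..<N}"
  shows "exponent_mset N (\<lambda>i. int (count M i)) = M"
  using assms by (intro multiset_eqI) (auto simp: count_exponent_mset not_in_iff[symmetric])

text \<open>The permutation \<open>w\<close> contributes \<open>x^\<beta>\<close> with \<open>\<beta> i = a i + w i\<close>. Rearranged by \<open>w\<close>, this exponent
  has the same weight \<open>\<Sum>(\<beta> i - i)^2\<close> as the original one, so it is again maximal, hence decreasing,
  which forces \<open>w = id\<close>: for a maximal exponent the alternating sum is a single coefficient.\<close>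

lemma eq_0_if_schur_dual_eq_0:
  assumes F: "F \<in> Lambda" and dual: "\<And>\<mu>. is_integer_partition \<mu> \<Longrightarrow> schur_dual \<mu> F = 0"
  shows "F = 0"
proof (rule ccontr)
  assume "F \<noteq> 0"
  then obtain M0 where M0: "scoeff F M0 \<noteq> 0" by (metis scoeff_zero series_eqI)
  obtain d where d: "\<And>M. scoeff F M \<noteq> 0 \<Longrightarrow> size M \<le> d"
    using F by (auto simp: Lambda_iff)
  have sym: "symmetric_series F" using F by (rule symmetric_Lambda)
  define N where "N = max 1 (card (set_mset M0))"
  define P where "P M \<longleftrightarrow> scoeff F M \<noteq> 0 \<and> set_mset M \<subseteq> {0..<N}" for M
  define f where "f M = (\<Sum>i = 0..<N. (int (count M i) - int i)\<^sup>2)" for M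
  have f_nonneg: "0 \<le> f M" for M by (simp add: f_def sum_nonneg)
  obtain \<pi> :: "nat \<Rightarrow> nat" where \<pi>: "bij \<pi>" "\<pi> ` set_mset M0 \<subseteq> {0..<N}"
    using ex_bij_into_initial_segment[of "set_mset M0" N] by (auto simp: N_def)
  have P0: "P (image_mset \<pi> M0)"
    using M0 \<pi> symmetric_seriesD[OF sym \<pi>(1)] by (simp add: P_def)
  \<comment> \<open>Exponents are at most \<open>d\<close> and positions below \<open>N\<close>, so
    the weight is bounded and a maximal exponent exists.\<close>
  have "\<forall>M. P M \<longrightarrow> nat (f M) < Suc (N * (d + N)\<^sup>2)"
  proof (intro allI impI)
    fix M assume "P M"
    have "f M \<le> (\<Sum>i = 0..<N. int ((d + N)\<^sup>2))"
      unfolding f_def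
    proof (rule sum_mono)
      fix i assume i: "i \<in> {0..<N}"
      have "count M i \<le> d"
        using d[of M] \<open>P M\<close> count_le_size[of M i] by (simp add: P_def)
      then have "\<bar>int (count M i) - int i\<bar> \<le> \<bar>int (d + N)\<bar>" using i by auto
      then show "(int (count M i) - int i)\<^sup>2 \<le> int ((d + N)\<^sup>2)"
        by (metis abs_le_square_iff of_nat_power)
    qed
    then show "nat (f M) < Suc (N * (d + N)\<^sup>2)"
      by (simp add: less_Suc_eq_le nat_le_iff)
  qed
  from ex_has_greatest_nat[of P, OF P0 this]
  obtain M where M: "P M" and "\<forall>M'. P M' \<longrightarrow> nat (f M') \<le> nat (f M)" by blast
  then have max: "f M' \<le> f M" if "P M'" for M'
    using that f_nonneg by (simp add: nat_le_eq_zle)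
  have decreasing: "int (count M' j) - int j < int (count M' i) - int i"
    if M': "P M'" "f M' = f M" and ij: "i < j" "j < N" for M' i j
  proof -
    let ?t = "transpose i j"
    have bij: "bij ?t" by simp
    have cnt: "count (image_mset ?t M') k = count M' (?t k)" for k
    proof -
      have "?t x = k \<longleftrightarrow> x = ?t k" for x by (metis transpose_involutory)
      then show ?thesis by (induction M') simp_all
    qed
    have "set_mset (image_mset ?t M') \<subseteq> {0..<N}"
      using M'(1) ij by (auto simp: P_def transpose_def)
    then have "P (image_mset ?t M')"
      using M'(1) symmetric_seriesD[OF sym bij] by (simp add: P_def)
    then have le: "f (image_mset ?t M') \<le> f M'" using max M'(2) by simp
    let ?g = "\<lambda>M k. (int (count M k) - int k)\<^sup>2"
    have split: "f K = ?g K i + ?g K j + (\<Sum>k\<in>{0..<N} - {i} - {j}. ?g K k)" for K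
      using sum.remove[of "{0..<N}" i "?g K"] sum.remove[of "{0..<N} - {i}" j "?g K"] ij
      by (simp add: f_def)
    have "(\<Sum>k\<in>{0..<N} - {i} - {j}. ?g (image_mset ?t M') k) = (\<Sum>k\<in>{0..<N} - {i} - {j}. ?g M' k)"
      by (rule sum.cong) (auto simp: cnt transpose_def)
    then have "?g (image_mset ?t M') i + ?g (image_mset ?t M') j \<le> ?g M' i + ?g M' j"
      using le split[of M'] split[of "image_mset ?t M'"] by simp
    then have "(int (count M' j) - int i)\<^sup>2 + (int (count M' i) - int j)\<^sup>2 \<le> ?g M' i + ?g M' j"
      by (simp add: cnt)
    \<comment> \<open>Swapping the exponents at \<open>i\<close> and \<open>j\<close> lowers the
      weight by twice this product; maximality makes it nonnegative.\<close>
    then have "0 \<le> (int j - int i) * (int (count M' i) - int (count M' j))"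
      by (simp add: power2_eq_square algebra_simps)
    then have "count M' j \<le> count M' i"
      using ij(1) by (simp add: zero_le_mult_iff)
    then show ?thesis using ij(1) by simp
  qed
  define a where "a i = int (count M i) - int i" for i
  have a_dec: "a j < a i" if "i < j" "j < N" for i j
    using decreasing[OF M refl that] by (simp add: a_def)
  have "0 < a i + int N" if "i < N" for i using that by (simp add: a_def)
  then obtain \<mu> where \<mu>: "is_integer_partition \<mu>" "length \<mu> \<le> N"
    and eq: "\<And>i. i < N \<Longrightarrow> padded \<mu> i - int i = a i"
    using partition_of_strictly_decreasing[of N a] a_dec by blast
  have "schur_dual \<mu> F = alternate N (vector_coeff F N) a"
    unfolding schur_dual_eq_alternate_padded[OF sym \<mu>(2)]
    by (rule alternate_cong[OF stable_vector_coeff[OF sym]]) (rule eq)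
  also have "\<dots> = (\<Sum>w | w permutes {0..<N}. if w = id then scoeff F M else 0)"
    unfolding alternate_def
  proof (rule sum.cong[OF refl])
    fix w assume "w \<in> {w. w permutes {0..<N}}"
    then have w: "w permutes {0..<N}" by simp
    let ?\<beta> = "\<lambda>i. a i + int (w i)"
    show "signof w * vector_coeff F N ?\<beta> = (if w = id then scoeff F M else 0)"
    proof (cases "w = id")
      case True
      have "?\<beta> = (\<lambda>i. int (count M i))" by (simp add: True a_def)
      then show ?thesis
        using True M exponent_mset_count[of M N] by (simp add: vector_coeff_def P_def)
    next
      case False
      have "vector_coeff F N ?\<beta> = 0"
      proof (rule ccontr)
        assume nz: "vector_coeff F N ?\<beta> \<noteq> 0"
        then have nonneg: "\<And>i. i < N \<Longrightarrow> 0 \<le> ?\<beta> i" and "scoeff F (exponent_mset N ?\<beta>) \<noteq> 0"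
          by (auto simp: vector_coeff_def split: if_splits)
        define v where "v = inv_into UNIV w"
        have v: "v permutes {0..<N}" unfolding v_def by (rule permutes_inv[OF w])
        have wv: "w (v i) = i" for i unfolding v_def by (rule permutes_inverses(1)[OF w])
        \<comment> \<open>The rearranged exponent is \<open>a (v i) + i\<close> at position
          \<open>i\<close>; after subtraction of the position, the entries of \<open>a\<close>
          appear in the order given by \<open>v\<close>.\<close>
        let ?M' = "image_mset w (exponent_mset N ?\<beta>)"
        have M'_eq: "?M' = exponent_mset N (\<lambda>i. a (v i) + int i)"
          using exponent_mset_permute[OF w, of "\<lambda>i. a (v i) + int i"]
          by (simp add: o_def v_def permutes_inverses(2)[OF w])
        have vi: "v i < N" if "i < N" for i
          using permutes_in_image[OF v, of i] that by simp
        have cnt: "int (count ?M' i) - int i = a (v i)" if "i < N" for i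
          using that nonneg[OF vi[OF that]] by (simp add: M'_eq count_exponent_mset wv)
        have P: "P ?M'"
          using \<open>scoeff F (exponent_mset N ?\<beta>) \<noteq> 0\<close> symmetric_seriesD[OF sym permutes_bij[OF w]]
            set_exponent_mset[of N "\<lambda>i. a (v i) + int i"] by (simp add: P_def flip: M'_eq)
        have "f ?M' = (\<Sum>i = 0..<N. ((\<lambda>i. (a i)\<^sup>2) \<circ> v) i)"
          unfolding f_def by (rule sum.cong) (simp_all add: cnt del: count_image_mset)
        also have "\<dots> = f M"
          unfolding f_def a_def[symmetric] by (rule sum.permute[OF v, symmetric])
        finally have fM': "f ?M' = f M" .
        have "v i < v j" if ij: "i < j" "j < N" for i j
        proof (rule ccontr)
          assume "\<not> v i < v j"
          moreover have "v i \<noteq> v j" using wv ij by (metis less_irrefl)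
          ultimately have "a (v i) < a (v j)" using vi ij by (intro a_dec) auto
          then show False using decreasing[OF P fM' ij] cnt ij by simp
        qed
        then have "v = id" by (rule strictly_increasing_permutation[OF v])
        then have "w = id" using wv by (auto simp: id_def)
        with False show False by simp
      qed
      with False show ?thesis by simp
    qed
  qed
  also have "\<dots> = scoeff F M"
    by (subst sum.delta) (simp_all add: finite_permutations permutes_id)
  finally show False using M dual[OF \<mu>(1)] by (simp add: P_def)
qed

lemma size_exponent_mset: "size (exponent_mset n \<alpha>) = (\<Sum>i = 0..<n. nat (\<alpha> i))"
  unfolding exponent_mset_def by (induction n) simp_all

lemma sum_shifted_by_permutation:
  assumes w: "w permutes {0..<length \<nu>}"
  shows "(\<Sum>i = 0..<length \<nu>. padded \<nu> i - int i + int (w i)) = sum_list \<nu>"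
proof -
  let ?n = "length \<nu>"
  have "(\<Sum>i = 0..<?n. padded \<nu> i - int i + int (w i))
      = (\<Sum>i = 0..<?n. padded \<nu> i) - (\<Sum>i = 0..<?n. int i) + (\<Sum>i = 0..<?n. (int \<circ> w) i)"
    by (simp add: sum.distrib sum_subtractf)
  also have "(\<Sum>i = 0..<?n. (int \<circ> w) i) = (\<Sum>i = 0..<?n. int i)"
    by (rule sum.permute[OF w, symmetric])
  also have "(\<Sum>i = 0..<?n. padded \<nu> i) = sum_list \<nu>"
    by (simp add: sum_list_sum_nth padded_def)
  finally show ?thesis by simp
qed

text \<open>Permutations do not change the sum of the exponents, so only the homogeneous part of
  degree \<open>sum_list \<nu>\<close> is seen.\<close>

lemma schur_dual_cong:
  assumes "\<And>M. int (size M) = sum_list \<nu> \<Longrightarrow> scoeff P M = scoeff Q M"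
  shows "schur_dual \<nu> P = schur_dual \<nu> Q"
proof -
  let ?n = "length \<nu>"
  have "vector_coeff P ?n (\<lambda>i. padded \<nu> i - int i + int (w i))
      = vector_coeff Q ?n (\<lambda>i. padded \<nu> i - int i + int (w i))"
    if w: "w permutes {0..<?n}" for w
  proof (cases "\<forall>i<?n. 0 \<le> padded \<nu> i - int i + int (w i)")
    case True
    have "int (size (exponent_mset ?n (\<lambda>i. padded \<nu> i - int i + int (w i))))
        = (\<Sum>i = 0..<?n. padded \<nu> i - int i + int (w i))"
      using True by (simp add: size_exponent_mset)
    also have "\<dots> = sum_list \<nu>" by (rule sum_shifted_by_permutation[OF w])
    finally show ?thesis
      using assms True by (simp add: vector_coeff_def)
  qed (auto simp: vector_coeff_def)
  then show ?thesis
    unfolding schur_dual_def alternate_def by (intro sum.cong) auto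
qed

lemma vector_coeff_add: "vector_coeff (P + Q) n \<alpha> = vector_coeff P n \<alpha> + vector_coeff Q n \<alpha>"
  by (auto simp: vector_coeff_def)

lemma vector_coeff_scale: "vector_coeff (series_scale c P) n \<alpha> = c * vector_coeff P n \<alpha>"
  by (auto simp: vector_coeff_def)

lemma schur_dual_add: "schur_dual \<nu> (P + Q) = schur_dual \<nu> P + schur_dual \<nu> Q"
  by (simp add: schur_dual_def alternate_def vector_coeff_add algebra_simps sum.distrib)

lemma schur_dual_scale: "schur_dual \<nu> (series_scale c P) = c * schur_dual \<nu> P"
  by (simp add: schur_dual_def alternate_def vector_coeff_scale sum_distrib_left ac_simps)

lemma schur_dual_zero [simp]: "schur_dual \<nu> 0 = 0"
  using schur_dual_scale[of \<nu> 0 0] by simp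

lemma schur_dual_diff: "schur_dual \<nu> (P - Q) = schur_dual \<nu> P - schur_dual \<nu> Q"
  using schur_dual_add[of \<nu> "P - Q" Q] by simp

lemma schur_dual_sum: "schur_dual \<nu> (sum f I) = (\<Sum>i\<in>I. schur_dual \<nu> (f i))"
  by (induction I rule: infinite_finite_induct) (simp_all add: schur_dual_add)

text \<open>A bound instead of a fixed size, because elements of \<open>Lambda\<close> need not be
  homogeneous.\<close>

definition partitions_upto :: "nat \<Rightarrow> int list set" where
  "partitions_upto d = {\<mu>. is_integer_partition \<mu> \<and> sum_list \<mu> \<le> int d}"

lemma finite_partitions_upto: "finite (partitions_upto d)"
proof (rule finite_subset)
  show "partitions_upto d \<subseteq> {\<mu>. set \<mu> \<subseteq> {1..int d} \<and> length \<mu> \<le> d}"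
  proof
    fix \<mu> assume "\<mu> \<in> partitions_upto d"
    then have pos: "\<forall>r\<in>set \<mu>. r > 0" and sum: "sum_list \<mu> \<le> int d"
      by (simp_all add: partitions_upto_def is_integer_partition_def)
    have "int (length \<mu>) \<le> sum_list \<mu>"
      using pos by (induction \<mu>) auto
    moreover have "r \<le> sum_list \<mu>" if "r \<in> set \<mu>" for r
      using pos that by (intro member_le_sum_list) auto
    ultimately show "\<mu> \<in> {\<mu>. set \<mu> \<subseteq> {1..int d} \<and> length \<mu> \<le> d}"
      using pos sum by fastforce
  qed
  show "finite {\<mu>. set \<mu> \<subseteq> {1..int d} \<and> length \<mu> \<le> d}"
    by (rule finite_lists_length_le) simp
qed

lemma schur_dual_eq_0_if_degree_less:
  assumes "\<And>M. scoeff F M \<noteq> 0 \<Longrightarrow> size M \<le> d" and "int d < sum_list \<nu>"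
  shows "schur_dual \<nu> F = 0"
proof -
  have "schur_dual \<nu> F = schur_dual \<nu> 0"
    using assms by (intro schur_dual_cong) fastforce
  then show ?thesis by simp
qed

lemma schur_expansion:
  assumes F: "F \<in> Lambda" and d: "\<And>M. scoeff F M \<noteq> 0 \<Longrightarrow> size M \<le> d"
  shows "F = (\<Sum>\<mu>\<in>partitions_upto d. series_scale (schur_dual \<mu> F) (schur \<mu>))" (is "_ = ?S")
proof -
  have "F - ?S = 0"
  proof (rule eq_0_if_schur_dual_eq_0)
    show "F - ?S \<in> Lambda"
      by (intro Lambda_diff F Lambda_sum Lambda_scale Lambda_schur)
    fix \<mu> assume \<mu>: "is_integer_partition \<mu>"
    have "schur_dual \<mu> ?S = (\<Sum>\<kappa>\<in>partitions_upto d. if \<kappa> = \<mu> then schur_dual \<mu> F else 0)"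
      unfolding schur_dual_sum schur_dual_scale
      by (intro sum.cong refl) (auto simp: partitions_upto_def schur_dual_schur[OF \<mu>])
    also have "\<dots> = (if \<mu> \<in> partitions_upto d then schur_dual \<mu> F else 0)"
      by (simp add: finite_partitions_upto)
    also have "\<dots> = schur_dual \<mu> F"
      using schur_dual_eq_0_if_degree_less[of F d \<mu>] d \<mu> by (auto simp: partitions_upto_def)
    finally show "schur_dual \<mu> (F - ?S) = 0" by (simp add: schur_dual_diff)
  qed
  then show ?thesis by simp
qed

lemma schur_basis_independent: "series.independent schur_basis"
proof
  assume "series.dependent schur_basis"
  then obtain t u where t: "finite t" "t \<subseteq> schur_basis"
    and sum: "(\<Sum>b\<in>t. series_scale (u b) b) = 0" and nz: "\<exists>b\<in>t. u b \<noteq> 0"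
    unfolding series.dependent_explicit by blast
  obtain b where b: "b \<in> t" "u b \<noteq> 0" using nz by blast
  then obtain \<mu> where \<mu>: "is_integer_partition \<mu>" "b = schur \<mu>"
    using t(2) by (auto simp: schur_basis_def)
  have "schur_dual \<mu> c = (if c = b then 1 else 0)" if "c \<in> t" for c
  proof -
    obtain \<kappa> where \<kappa>: "is_integer_partition \<kappa>" "c = schur \<kappa>"
      using t(2) \<open>c \<in> t\<close> by (auto simp: schur_basis_def)
    then show ?thesis
      using schur_dual_schur[OF \<mu>(1)] \<mu> by (metis zero_neq_one)
  qed
  then have "schur_dual \<mu> (\<Sum>b\<in>t. series_scale (u b) b) = (\<Sum>c\<in>t. if c = b then u b else 0)"
    unfolding schur_dual_sum schur_dual_scale by (intro sum.cong) auto
  also have "\<dots> = u b" using t(1) b(1) by simp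
  finally show False using b(2) by (simp add: sum)
qed

lemma span_schur_basis: "F \<in> Lambda \<Longrightarrow> F \<in> series.span schur_basis"
proof -
  assume F: "F \<in> Lambda"
  then obtain d where d: "\<And>M. scoeff F M \<noteq> 0 \<Longrightarrow> size M \<le> d"
    by (auto simp: Lambda_iff)
  have "schur \<mu> \<in> schur_basis" if "\<mu> \<in> partitions_upto d" for \<mu>
    using that by (auto simp: schur_basis_def partitions_upto_def)
  then have "(\<Sum>\<mu>\<in>partitions_upto d. series_scale (schur_dual \<mu> F) (schur \<mu>))
      \<in> series.span schur_basis"
    by (intro series.span_sum series.span_scale series.span_base)
  moreover have "F = (\<Sum>\<mu>\<in>partitions_upto d. series_scale (schur_dual \<mu> F) (schur \<mu>))"
    using F d by (rule schur_expansion)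
  ultimately show ?thesis by argo
qed

text \<open>The abstract coordinates in the definition of the scalar product become computable
  here.\<close>

lemma representation_schur:
  assumes F: "F \<in> Lambda" and \<mu>: "is_integer_partition \<mu>"
  shows "series.representation schur_basis F (schur \<mu>) = schur_dual \<mu> F"
proof -
  let ?r = "series.representation schur_basis F"
  have fin: "finite {b. ?r b \<noteq> 0}" by (rule series.finite_representation)
  have "schur_dual \<mu> F = schur_dual \<mu> (\<Sum>b | ?r b \<noteq> 0. series_scale (?r b) b)"
    by (subst series.sum_nonzero_representation_eq[OF schur_basis_independent span_schur_basis[OF F]])
      simp
  also have "\<dots> = (\<Sum>b | ?r b \<noteq> 0. if b = schur \<mu> then ?r (schur \<mu>) else 0)"
    unfolding schur_dual_sum schur_dual_scale
  proof (rule sum.cong[OF refl])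
    fix b assume "b \<in> {b. ?r b \<noteq> 0}"
    then have "b \<in> schur_basis" by (auto intro: series.representation_ne_zero)
    then obtain \<kappa> where \<kappa>: "is_integer_partition \<kappa>" "b = schur \<kappa>"
      by (auto simp: schur_basis_def)
    show "?r b * schur_dual \<mu> b = (if b = schur \<mu> then ?r (schur \<mu>) else 0)"
      using schur_dual_schur[OF \<mu> \<kappa>(1)] schur_dual_schur[OF \<mu> \<mu>] \<kappa>(2) by (auto split: if_splits)
  qed
  also have "\<dots> = ?r (schur \<mu>)" using fin by simp
  finally show ?thesis by simp
qed

section \<open>The scalar product, adjoints, and skewing by series of unbounded degree\<close>

section \<open>The scalar product\<close>

definition degree_le :: "nat \<Rightarrow> 'v series \<Rightarrow> bool" where
  "degree_le d F \<longleftrightarrow> (\<forall>M. scoeff F M \<noteq> 0 \<longrightarrow> size M \<le> d)"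

lemma Lambda_degree_le: "F \<in> Lambda \<Longrightarrow> \<exists>d. degree_le d F"
  by (simp add: Lambda_iff degree_le_def)

lemma degree_le_mono: "degree_le d F \<Longrightarrow> d \<le> e \<Longrightarrow> degree_le e F"
  using le_trans unfolding degree_le_def by blast

lemma degree_le_scale: "degree_le d F \<Longrightarrow> degree_le d (series_scale c F)"
  by (simp add: degree_le_def)

lemma degree_le_sum:
  assumes "\<And>i. i \<in> I \<Longrightarrow> degree_le d (f i)"
  shows "degree_le d (sum f I)"
  unfolding degree_le_def
proof (intro allI impI)
  fix M assume "scoeff (sum f I) M \<noteq> 0"
  then obtain i where "i \<in> I" "scoeff (f i) M \<noteq> 0"
    unfolding scoeff_sum by (meson sum.neutral)
  then show "size M \<le> d" using assms by (auto simp: degree_le_def)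
qed

lemma scalar_product_eq:
  assumes P: "P \<in> Lambda" "degree_le d P" and Q: "Q \<in> Lambda"
  shows "scalar_product P Q = (\<Sum>\<mu>\<in>partitions_upto d. schur_dual \<mu> P * schur_dual \<mu> Q)"
proof -
  let ?r = "series.representation schur_basis"
  have part: "is_integer_partition \<mu>" if "\<mu> \<in> partitions_upto d" for \<mu>
    using that by (simp add: partitions_upto_def)
  have inj: "inj_on schur (partitions_upto d)"
  proof (rule inj_onI)
    fix \<mu> \<nu> assume "\<mu> \<in> partitions_upto d" "\<nu> \<in> partitions_upto d" "schur \<mu> = schur \<nu>"
    then show "\<mu> = \<nu>"
      using schur_dual_schur[of \<mu> \<mu>] schur_dual_schur[of \<mu> \<nu>] part by (metis zero_neq_one)
  qed
  have "scalar_product P Q = (\<Sum>b\<in>schur ` partitions_upto d. ?r P b * ?r Q b)"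
    unfolding scalar_product_def
  proof (rule Sum_any.expand_superset)
    show "finite (schur ` partitions_upto d)" by (simp add: finite_partitions_upto)
    show "{b. ?r P b * ?r Q b \<noteq> 0} \<subseteq> schur ` partitions_upto d"
    proof
      fix b assume "b \<in> {b. ?r P b * ?r Q b \<noteq> 0}"
      then have nz: "?r P b \<noteq> 0" by auto
      then have "b \<in> schur_basis" by (rule series.representation_ne_zero)
      then obtain \<mu> where \<mu>: "is_integer_partition \<mu>" "b = schur \<mu>"
        by (auto simp: schur_basis_def)
      then have "schur_dual \<mu> P \<noteq> 0" using nz representation_schur[OF P(1)] by simp
      then have "sum_list \<mu> \<le> int d"
        using schur_dual_eq_0_if_degree_less[of P d \<mu>] P(2)
        by (meson degree_le_def not_less)
      then show "b \<in> schur ` partitions_upto d"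
        using \<mu> by (simp add: partitions_upto_def)
    qed
  qed
  also have "\<dots> = (\<Sum>\<mu>\<in>partitions_upto d. schur_dual \<mu> P * schur_dual \<mu> Q)"
    unfolding sum.reindex[OF inj] o_def
    by (intro sum.cong refl) (simp add: representation_schur[OF P(1) part] representation_schur[OF Q part])
  finally show ?thesis .
qed

lemma scalar_product_commute: "scalar_product P Q = scalar_product Q P"
  by (simp add: scalar_product_def mult.commute)

text \<open>An element of degree at most \<open>d\<close> is orthogonal to everything of higher
  degree; this justifies the truncations below.\<close>

lemma scalar_product_cong_right:
  assumes P: "P \<in> Lambda" "degree_le d P" and "Q \<in> Lambda" "Q' \<in> Lambda"
    and eq: "\<And>M. size M \<le> d \<Longrightarrow> scoeff Q M = scoeff Q' M"
  shows "scalar_product P Q = scalar_product P Q'"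
proof -
  have "schur_dual \<mu> Q = schur_dual \<mu> Q'" if "\<mu> \<in> partitions_upto d" for \<mu>
    by (rule schur_dual_cong, rule eq) (use that in \<open>simp add: partitions_upto_def\<close>)
  then show ?thesis using assms(3,4) by (simp add: scalar_product_eq[OF P])
qed

lemma scalar_product_add_right:
  assumes P: "P \<in> Lambda" and Q: "Q \<in> Lambda" "Q' \<in> Lambda"
  shows "scalar_product P (Q + Q') = scalar_product P Q + scalar_product P Q'"
proof -
  obtain d where d: "degree_le d P" using Lambda_degree_le[OF P] by blast
  show ?thesis
    using Q by (simp add: scalar_product_eq[OF P d] Lambda_add schur_dual_add distrib_left sum.distrib)
qed

lemma scalar_product_scale_right:
  assumes P: "P \<in> Lambda" and Q: "Q \<in> Lambda"
  shows "scalar_product P (series_scale c Q) = c * scalar_product P Q"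
proof -
  obtain d where d: "degree_le d P" using Lambda_degree_le[OF P] by blast
  show ?thesis
    using Q by (simp add: scalar_product_eq[OF P d] Lambda_scale schur_dual_scale sum_distrib_left
      mult.left_commute)
qed

lemma scalar_product_zero_right [simp]: "P \<in> Lambda \<Longrightarrow> scalar_product P 0 = 0"
  using scalar_product_scale_right[of P 0 0] by simp

lemma scalar_product_sum_right:
  assumes "P \<in> Lambda" "\<And>i. i \<in> I \<Longrightarrow> f i \<in> Lambda"
  shows "scalar_product P (sum f I) = (\<Sum>i\<in>I. scalar_product P (f i))"
  using assms(2)
  by (induction I rule: infinite_finite_induct)
    (simp_all add: assms(1) scalar_product_add_right Lambda_sum)

lemma scalar_product_sum_left:
  assumes "P \<in> Lambda" "\<And>i. i \<in> I \<Longrightarrow> f i \<in> Lambda"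
  shows "scalar_product (sum f I) P = (\<Sum>i\<in>I. scalar_product (f i) P)"
  using scalar_product_sum_right[OF assms] by (simp only: scalar_product_commute[of P])

lemma signof_mult_eq_scale: "signof w * (F :: 'v series) = series_scale (signof w) F"
  by (rule series_eqI) (simp add: scoeff_signof_mult)

lemma minus_one_power_mult_eq_scale: "(-1) ^ j * (F :: 'v series) = series_scale ((-1) ^ j) F"
  by (rule series_eqI) simp

lemma scalar_product_schur:
  assumes \<mu>: "is_integer_partition \<mu>" and Q: "Q \<in> Lambda"
  shows "scalar_product (schur \<mu>) Q = schur_dual \<mu> Q"
proof -
  obtain d where d: "degree_le d (schur \<mu>)" using Lambda_degree_le[OF Lambda_schur] by blast
  define e where "e = max d (nat (sum_list \<mu>))"
  have "degree_le e (schur \<mu>)" using d by (rule degree_le_mono) (simp add: e_def)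
  then have "scalar_product (schur \<mu>) Q
      = (\<Sum>\<kappa>\<in>partitions_upto e. schur_dual \<kappa> (schur \<mu>) * schur_dual \<kappa> Q)"
    by (rule scalar_product_eq[OF Lambda_schur _ Q])
  also have "\<dots> = (\<Sum>\<kappa>\<in>partitions_upto e. if \<kappa> = \<mu> then schur_dual \<mu> Q else 0)"
    by (intro sum.cong refl) (auto simp: partitions_upto_def schur_dual_schur[OF _ \<mu>])
  also have "\<dots> = schur_dual \<mu> Q"
    using \<mu> by (simp add: finite_partitions_upto) (auto simp: partitions_upto_def e_def)
  finally show ?thesis .
qed

text \<open>For fixed \<open>Q\<close>, both the pairing with a complete product and the coefficient
  of \<open>Q\<close> are stable families. Their difference has vanishing alternating sums at
  partitions by orthonormality, hence at every integer vector.\<close>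

lemma scalar_product_alternate:
  assumes Q: "Q \<in> Lambda"
  shows "scalar_product (alternate n (complete_product n) a) Q = alternate n (vector_coeff Q n) a"
proof -
  let ?F = "\<lambda>n \<alpha>. scalar_product (complete_product n \<alpha>) Q - vector_coeff Q n \<alpha>"
  have zero: "scalar_product 0 Q = 0"
    using Q by (simp add: scalar_product_commute[of 0])
  have alt: "alternate n (?F n) a
      = scalar_product (alternate n (complete_product n) a) Q - alternate n (vector_coeff Q n) a" for n a
  proof -
    have "scalar_product Q (alternate n (complete_product n) a)
        = (\<Sum>w | w permutes {0..<n}. signof w * scalar_product Q (complete_product n (\<lambda>i. a i + int (w i))))"
      unfolding alternate_def signof_mult_eq_scale
      by (simp add: scalar_product_sum_right scalar_product_scale_right Q Lambda_scale
        Lambda_complete_product)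
    then show ?thesis
      by (simp add: alternate_def scalar_product_commute[of _ Q] right_diff_distrib sum_subtractf)
  qed
  have "stable_family ?F"
    using stable_familyD[OF stable_complete_product]
      stable_familyD[OF stable_vector_coeff[OF symmetric_Lambda[OF Q]]]
    unfolding stable_family_def
    by (intro conjI allI impI) (metis zero diff_self)+
  then have "alternate n (?F n) a = 0"
  proof (rule alternate_eq_0_if_partitions)
    fix \<mu> assume "is_integer_partition \<mu>"
    then show "alternate (length \<mu>) (?F (length \<mu>)) (\<lambda>i. padded \<mu> i - int i) = 0"
      unfolding alt using scalar_product_schur[OF _ Q] by (simp add: schur_eq_alternate schur_dual_def)
  qed
  then show ?thesis by (simp add: alt)
qed

lemma scalar_product_left_eqD:
  assumes R: "R \<in> Lambda" "R' \<in> Lambda"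
    and eq: "\<And>S. S \<in> Lambda \<Longrightarrow> scalar_product R S = scalar_product R' S"
  shows "R = R'"
proof -
  have "R - R' = 0"
  proof (rule eq_0_if_schur_dual_eq_0)
    show "R - R' \<in> Lambda" using R by (rule Lambda_diff)
    fix \<mu> assume "is_integer_partition \<mu>"
    then show "schur_dual \<mu> (R - R') = 0"
      using eq[OF Lambda_schur, of \<mu>] scalar_product_schur[of \<mu>] R
      by (simp add: schur_dual_diff scalar_product_commute[of _ "schur \<mu>"])
  qed
  then show ?thesis by simp
qed

section \<open>Skewing\<close>

lemma scoeff_complete_product_nonzero:
  "scoeff (complete_product n \<alpha>) M \<noteq> 0 \<Longrightarrow> int (size M) = (\<Sum>i = 0..<n. \<alpha> i)"
proof (induction n arbitrary: M)
  case (Suc n)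
  have "complete_product (Suc n) \<alpha> = complete_product n \<alpha> * complete_homogeneous (\<alpha> n)"
    by (simp add: complete_product_def)
  then obtain A B where A: "M = A + B" "scoeff (complete_product n \<alpha>) A \<noteq> 0"
    "scoeff (complete_homogeneous (\<alpha> n)) B \<noteq> 0"
    using Suc.prems by (metis scoeff_times_nonzeroE)
  then have "int (size B) = \<alpha> n"
    by (simp add: complete_homogeneous_def split: if_splits)
  then show ?case using Suc.IH[OF A(2)] A(1) by simp
qed (simp add: complete_product_def scoeff_one split: if_splits)

lemma scoeff_schur_nonzero:
  assumes "scoeff (schur \<nu>) M \<noteq> 0"
  shows "int (size M) = sum_list \<nu>"
proof -
  let ?n = "length \<nu>"
  obtain w where w: "w permutes {0..<?n}"
    and "scoeff (complete_product ?n (\<lambda>i. padded \<nu> i - int i + int (w i))) M \<noteq> 0"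
    by (rule sum.not_neutral_contains_not_neutral
        [OF assms[unfolded schur_eq_alternate alternate_def scoeff_sum scoeff_signof_mult]]) auto
  then have "int (size M) = (\<Sum>i = 0..<?n. padded \<nu> i - int i + int (w i))"
    by (rule_tac scoeff_complete_product_nonzero)
  then show ?thesis by (simp add: sum_shifted_by_permutation[OF w])
qed

text \<open>Keeps products with infinite series inside \<open>Lambda\<close>, where the scalar
  product is defined.\<close>

definition truncate :: "nat \<Rightarrow> 'v series \<Rightarrow> 'v series" where
  "truncate D F = Series (\<lambda>M. if size M \<le> D then scoeff F M else 0)"

lemma scoeff_truncate: "scoeff (truncate D F) M = (if size M \<le> D then scoeff F M else 0)"
  by (simp add: truncate_def)

lemma Lambda_truncate: "symmetric_series F \<Longrightarrow> truncate D F \<in> Lambda"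
  by (auto simp: Lambda_iff scoeff_truncate symmetric_seriesD intro!: symmetric_seriesI)

lemma scalar_product_truncate:
  assumes "P \<in> Lambda" "degree_le D P" "Q \<in> Lambda"
  shows "scalar_product P (truncate D Q) = scalar_product P Q"
  using assms
  by (intro scalar_product_cong_right[of P D])
    (simp_all add: Lambda_truncate symmetric_Lambda scoeff_truncate)

lemma truncate_mult_truncate: "truncate D (P * truncate D S) = truncate D (P * S)"
proof (rule series_eqI)
  fix M
  have "scoeff P A * scoeff (truncate D S) (M - A) = scoeff P A * scoeff S (M - A)"
    if "size M \<le> D" for A
    using that by (simp add: scoeff_truncate le_trans[OF size_mset_mono[OF diff_subset_eq_self]])
  then have "scoeff (P * truncate D S) M = scoeff (P * S) M" if "size M \<le> D"
    unfolding scoeff_times using that by (intro sum.cong refl)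
  then show "scoeff (truncate D (P * truncate D S)) M = scoeff (truncate D (P * S)) M"
    by (simp add: scoeff_truncate)
qed

lemma truncate_eq_sum_homogeneous_part: "truncate D F = (\<Sum>d\<le>D. homogeneous_part d F)"
  by (rule series_eqI) (simp add: scoeff_truncate homogeneous_part_def)

lemma Lambda_homogeneous_part: "symmetric_series F \<Longrightarrow> homogeneous_part d F \<in> Lambda"
  by (auto simp: Lambda_iff homogeneous_part_def symmetric_seriesD intro!: symmetric_seriesI)

lemma adjoint_eqI:
  assumes "R \<in> Lambda" "\<And>S. S \<in> Lambda \<Longrightarrow> scalar_product R S = scalar_product Q (P * S)"
  shows "adjoint P Q = R"
  unfolding adjoint_def
  by (rule the_equality) (use assms in \<open>auto intro: scalar_product_left_eqD\<close>)

text \<open>Orthonormality dictates the coordinates of the adjoint; those above the degree of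
  \<open>Q\<close> vanish, so a finite sum exists that has the required pairings.\<close>

lemma adjoint:
  assumes P: "P \<in> Lambda" and Q: "Q \<in> Lambda" "degree_le D Q"
  shows "adjoint P Q \<in> Lambda" "degree_le D (adjoint P Q)"
    and "S \<in> Lambda \<Longrightarrow> scalar_product (adjoint P Q) S = scalar_product Q (P * S)"
proof -
  let ?c = "\<lambda>\<mu>. scalar_product Q (P * schur \<mu>)"
  define R where "R = (\<Sum>\<mu>\<in>partitions_upto D. series_scale (?c \<mu>) (schur \<mu>))"
  have R: "R \<in> Lambda"
    unfolding R_def by (intro Lambda_sum Lambda_scale Lambda_schur)
  have "degree_le D (schur \<mu>)" if "\<mu> \<in> partitions_upto D" for \<mu>
    using that scoeff_schur_nonzero[of \<mu>] by (fastforce simp: degree_le_def partitions_upto_def)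
  then have deg: "degree_le D R"
    unfolding R_def by (intro degree_le_sum degree_le_scale)
  \<comment> \<open>All terms of \<open>P * schur \<mu>\<close> have degree at least the size of
    \<open>\<mu>\<close>, which exceeds \<open>D\<close>, so the product is orthogonal to
    \<open>Q\<close>.\<close>
  have c0: "?c \<mu> = 0" if "\<mu> \<notin> partitions_upto D" "is_integer_partition \<mu>" for \<mu>
  proof -
    have "scoeff (P * schur \<mu>) M = 0" if "size M \<le> D" for M
      unfolding scoeff_times
    proof (rule sum.neutral, rule ballI)
      fix A
      have "size (M - A) \<le> D"
        using size_mset_mono[OF diff_subset_eq_self[of M A]] \<open>size M \<le> D\<close> by (rule le_trans)
      then have "int (size (M - A)) \<noteq> sum_list \<mu>"
        using \<open>\<mu> \<notin> _\<close> \<open>is_integer_partition \<mu>\<close> by (auto simp: partitions_upto_def)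
      then show "scoeff P A * scoeff (schur \<mu>) (M - A) = 0"
        using scoeff_schur_nonzero by fastforce
    qed
    then have "?c \<mu> = scalar_product Q 0"
      using P Q by (intro scalar_product_cong_right[of Q D]) (simp_all add: Lambda_mult Lambda_schur)
    then show ?thesis using Q by simp
  qed
  have prod: "scalar_product R S = scalar_product Q (P * S)" if S: "S \<in> Lambda" for S
  proof -
    obtain d where d: "degree_le d S" using Lambda_degree_le[OF S] by blast
    define e where "e = max d D"
    have e: "degree_le e S" using d by (rule degree_le_mono) (simp add: e_def)
    have sub: "partitions_upto D \<subseteq> partitions_upto e" by (auto simp: partitions_upto_def e_def)
    have "S = (\<Sum>\<mu>\<in>partitions_upto e. series_scale (schur_dual \<mu> S) (schur \<mu>))"
      using S e by (intro schur_expansion) (auto simp: degree_le_def)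
    then have "P * S = (\<Sum>\<mu>\<in>partitions_upto e. series_scale (schur_dual \<mu> S) (P * schur \<mu>))"
      by (metis (no_types, lifting) series_scale_mult_right sum.cong sum_distrib_left)
    then have "scalar_product Q (P * S) = (\<Sum>\<mu>\<in>partitions_upto e. schur_dual \<mu> S * ?c \<mu>)"
      using P Q by (simp add: scalar_product_sum_right scalar_product_scale_right Lambda_scale
        Lambda_mult Lambda_schur)
    also have "\<dots> = (\<Sum>\<mu>\<in>partitions_upto D. schur_dual \<mu> S * ?c \<mu>)"
      by (rule sum.mono_neutral_right[OF finite_partitions_upto sub])
        (use c0 in \<open>auto simp: partitions_upto_def\<close>)
    also have "\<dots> = scalar_product S R"
      using S unfolding R_def
      by (simp add: scalar_product_sum_right scalar_product_scale_right Lambda_scale Lambda_schur)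
        (intro sum.cong refl, simp add: scalar_product_commute[of S] scalar_product_schur[OF _ S]
          partitions_upto_def mult.commute)
    finally show ?thesis by (simp add: scalar_product_commute)
  qed
  have "adjoint P Q = R" using R prod by (rule adjoint_eqI)
  then show "adjoint P Q \<in> Lambda" "degree_le D (adjoint P Q)"
    "S \<in> Lambda \<Longrightarrow> scalar_product (adjoint P Q) S = scalar_product Q (P * S)"
    using R deg prod by simp_all
qed

text \<open>Pieces of \<open>P\<close> of degree above \<open>D\<close> act as 0 on
  \<open>Q\<close>, which makes the sum finite. The last clause characterises skewing by one pairing
  and replaces the decomposition into pieces from here on.\<close>

lemma skew:
  assumes P: "symmetric_series P" and Q: "Q \<in> Lambda" "degree_le D Q"
  shows "skew P Q \<in> Lambda" "degree_le D (skew P Q)"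
    and "S \<in> Lambda \<Longrightarrow> scalar_product (skew P Q) S = scalar_product Q (truncate D (P * S))"
proof -
  have Pd: "homogeneous_part d P \<in> Lambda" for d
    using P by (rule Lambda_homogeneous_part)
  have "adjoint (homogeneous_part d P) Q = 0" if "D < d" for d
  proof (rule adjoint_eqI)
    fix S :: "nat series" assume S: "S \<in> Lambda"
    have "scoeff (homogeneous_part d P * S) M = 0" if "size M \<le> D" for M
      unfolding scoeff_times
    proof (rule sum.neutral, rule ballI)
      fix A assume "A \<in> {A. A \<subseteq># M}"
      then have "size A \<noteq> d" using size_mset_mono[of A M] that \<open>D < d\<close> by auto
      then show "scoeff (homogeneous_part d P) A * scoeff S (M - A) = 0"
        by (simp add: homogeneous_part_def)
    qed
    then have "scalar_product Q (homogeneous_part d P * S) = scalar_product Q 0"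
      using Q S Pd by (intro scalar_product_cong_right[of Q D]) (simp_all add: Lambda_mult)
    then show "scalar_product 0 S = scalar_product Q (homogeneous_part d P * S)"
      using Q S by (simp add: scalar_product_commute[of 0])
  qed simp
  then have "{d. adjoint (homogeneous_part d P) Q \<noteq> 0} \<subseteq> {..D}"
    by (intro subsetI CollectI) (simp add: not_less[symmetric], blast)
  then have eq: "skew P Q = (\<Sum>d\<le>D. adjoint (homogeneous_part d P) Q)"
    unfolding skew_def by (rule Sum_any.expand_superset[OF finite_atMost])
  show sk: "skew P Q \<in> Lambda" "degree_le D (skew P Q)"
    unfolding eq using adjoint(1,2)[OF Pd Q] by (auto intro: Lambda_sum degree_le_sum)
  assume S: "S \<in> Lambda"
  have "scalar_product (skew P Q) S = (\<Sum>d\<le>D. scalar_product Q (homogeneous_part d P * S))"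
    unfolding eq using adjoint(1,3)[OF Pd Q] S
    by (simp add: scalar_product_sum_left)
  also have "\<dots> = scalar_product Q (truncate D P * S)"
    unfolding truncate_eq_sum_homogeneous_part sum_distrib_right
    using Q S Pd by (simp add: scalar_product_sum_right Lambda_mult)
  also have "\<dots> = scalar_product Q (truncate D (truncate D P * S))"
    using Q S P by (simp add: scalar_product_truncate Lambda_mult Lambda_truncate)
  also have "truncate D (truncate D P * S) = truncate D (P * S)"
    using truncate_mult_truncate[of D S P] by (simp add: mult.commute)
  finally show "scalar_product (skew P Q) S = scalar_product Q (truncate D (P * S))" .
qed

lemma skew_eqI:
  assumes P: "symmetric_series P" and Q: "Q \<in> Lambda" "degree_le D Q" and R: "R \<in> Lambda"
    and eq: "\<And>S. S \<in> Lambda \<Longrightarrow> scalar_product R S = scalar_product Q (truncate D (P * S))"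
  shows "skew P Q = R"
  using skew(1)[OF P Q] R by (rule scalar_product_left_eqD) (simp add: skew(3)[OF P Q] eq)

text \<open>Adjoints compose in reverse order. Skewing does not raise the degree, so one bound
  \<open>D\<close> serves both truncations and the inner one is absorbed.\<close>

lemma skew_skew_inverse:
  assumes P: "symmetric_series P" "symmetric_series P'" and inv: "P * P' = 1" and Q: "Q \<in> Lambda"
  shows "skew P (skew P' Q) = Q"
proof -
  obtain D where D: "degree_le D Q" using Lambda_degree_le[OF Q] by blast
  note sk = skew[OF P(2) Q D]
  show ?thesis
  proof (rule skew_eqI[OF P(1) sk(1,2) Q])
    fix S assume S: "S \<in> Lambda"
    then have "truncate D (P * S) \<in> Lambda"
      using P by (simp add: Lambda_truncate symmetric_mult symmetric_Lambda)
    then have "scalar_product (skew P' Q) (truncate D (P * S))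
        = scalar_product Q (truncate D (P' * truncate D (P * S)))"
      by (rule sk(3))
    also have "truncate D (P' * truncate D (P * S)) = truncate D (P * P' * S)"
      by (simp add: truncate_mult_truncate ac_simps)
    also have "scalar_product Q \<dots> = scalar_product Q S"
      using Q D S by (simp add: inv scalar_product_truncate)
    finally show "scalar_product Q S = scalar_product (skew P' Q) (truncate D (P * S))" ..
  qed
qed

lemma skew_one:
  assumes P: "symmetric_series P" "scoeff P {#} = 1"
  shows "skew P 1 = 1"
proof (rule skew_eqI[OF P(1)])
  show deg: "degree_le 0 (1 :: nat series)" by (simp add: degree_le_def scoeff_one)
  fix S assume S: "S \<in> Lambda"
  have "truncate 0 (P * S) = truncate 0 S"
    by (rule series_eqI) (simp add: scoeff_truncate P(2))
  then show "scalar_product 1 S = scalar_product 1 (truncate 0 (P * S))"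
    using S deg by (simp add: scalar_product_truncate)
qed simp_all

section \<open>Bernstein's operators as prepending a row\<close>

section \<open>Bernstein's operators on Schur functions\<close>

text \<open>A squarefree monomial of degree \<open>j\<close> lowers \<open>j\<close> of the
  exponents by one. Choices that would lower a zero exponent contribute 0 by the convention of
  \<open>vector_coeff\<close>, so the index set need not depend on \<open>\<alpha>\<close>.\<close>

lemma vector_coeff_elementary_mult:
  "vector_coeff (elementary UNIV j * S) n \<alpha>
    = (\<Sum>I | I \<subseteq> {0..<n} \<and> card I = j. vector_coeff S n (\<lambda>i. \<alpha> i - of_bool (i \<in> I)))"
proof (cases "\<forall>i<n. \<alpha> i \<ge> 0")
  case True
  let ?M = "exponent_mset n \<alpha>"
  let ?\<I> = "{I. I \<subseteq> {0..<n} \<and> card I = j}"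
  have supp: "i \<in># ?M \<longleftrightarrow> i < n \<and> \<alpha> i > 0" for i
    by (auto simp: count_exponent_mset simp flip: count_greater_zero_iff split: if_splits)
  have "vector_coeff (elementary UNIV j * S) n \<alpha>
      = (\<Sum>I | I \<subseteq> UNIV \<inter> set_mset ?M \<and> card I = j. scoeff S (?M - mset_set I))"
    using True by (simp add: vector_coeff_def scoeff_elementary_mult)
  also have "\<dots> = (\<Sum>I\<in>?\<I>. vector_coeff S n (\<lambda>i. \<alpha> i - of_bool (i \<in> I)))"
  proof (rule sum.mono_neutral_cong_left)
    show "{I. I \<subseteq> UNIV \<inter> set_mset ?M \<and> card I = j} \<subseteq> ?\<I>"
      using supp by auto
    show "\<forall>I\<in>?\<I> - {I. I \<subseteq> UNIV \<inter> set_mset ?M \<and> card I = j}.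
        vector_coeff S n (\<lambda>i. \<alpha> i - of_bool (i \<in> I)) = 0"
    proof
      fix I assume "I \<in> ?\<I> - {I. I \<subseteq> UNIV \<inter> set_mset ?M \<and> card I = j}"
      then obtain i where "i \<in> I" "i \<notin># ?M" "I \<subseteq> {0..<n}" by blast
      then have i: "i \<in> I" "i < n" "\<not> \<alpha> i > 0" using supp by auto
      then have "\<alpha> i - of_bool (i \<in> I) < 0" by simp
      then show "vector_coeff S n (\<lambda>i. \<alpha> i - of_bool (i \<in> I)) = 0"
        using i(2) unfolding vector_coeff_def by (meson not_less)
    qed
    fix I assume I: "I \<in> {I. I \<subseteq> UNIV \<inter> set_mset ?M \<and> card I = j}"
    have fin: "finite I" using I finite_subset[of I "set_mset ?M"] by simp
    have pos: "i < n" "\<alpha> i > 0" if "i \<in> I" for i using I supp that by auto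
    have "?M - mset_set I = exponent_mset n (\<lambda>i. \<alpha> i - of_bool (i \<in> I))"
      using fin pos by (intro multiset_eqI) (auto simp: count_exponent_mset count_mset_set')
    moreover have "\<forall>i<n. \<alpha> i - of_bool (i \<in> I) \<ge> 0"
      using True pos(2) by (force simp: of_bool_def)
    ultimately show "scoeff S (?M - mset_set I) = vector_coeff S n (\<lambda>i. \<alpha> i - of_bool (i \<in> I))"
      unfolding vector_coeff_def by presburger
  qed simp
  finally show ?thesis .
next
  case False
  then obtain i where i: "i < n" "\<alpha> i < 0" by (auto simp: not_le)
  have "vector_coeff S n (\<lambda>i. \<alpha> i - of_bool (i \<in> I)) = 0" for I
  proof -
    have "\<alpha> i - of_bool (i \<in> I) < 0" using i(2) by (simp add: of_bool_def)
    then show ?thesis using i(1) unfolding vector_coeff_def by (meson not_less)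
  qed
  moreover have "vector_coeff (elementary UNIV j * S) n \<alpha> = 0"
    using False unfolding vector_coeff_def by (rule if_not_P)
  ultimately show ?thesis by simp
qed

lemma skew_elementary_alternate:
  "skew ((-1) ^ j * elementary UNIV j) (alternate n (complete_product n) a)
    = (-1) ^ j * (\<Sum>I | I \<subseteq> {0..<n} \<and> card I = j.
        alternate n (complete_product n) (\<lambda>i. a i - of_bool (i \<in> I)))"
    (is "skew ?P ?Q = (-1) ^ j * (\<Sum>I\<in>?\<I>. ?R I)")
proof -
  have alt: "alternate n (complete_product n) b \<in> Lambda" for b
    unfolding alternate_def by (intro Lambda_sum Lambda_signof Lambda_complete_product)
  then obtain D where D: "degree_le D ?Q" using Lambda_degree_le by blast
  have P: "?P \<in> Lambda" by (intro Lambda_minus_one_power Lambda_elementary)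
  show ?thesis
  proof (rule skew_eqI[OF symmetric_Lambda[OF P] alt D])
    show "(-1) ^ j * (\<Sum>I\<in>?\<I>. ?R I) \<in> Lambda"
      by (intro Lambda_minus_one_power Lambda_sum alt)
    fix S assume S: "S \<in> Lambda"
    have "scalar_product ?Q (truncate D (?P * S)) = scalar_product ?Q (?P * S)"
      by (intro scalar_product_truncate alt D Lambda_mult P S)
    also have "\<dots> = (-1) ^ j * scalar_product ?Q (elementary UNIV j * S)"
      unfolding minus_one_power_mult_eq_scale series_scale_mult_left
      by (intro scalar_product_scale_right alt Lambda_mult Lambda_elementary S)
    also have "scalar_product ?Q (elementary UNIV j * S)
        = alternate n (vector_coeff (elementary UNIV j * S) n) a"
      by (intro scalar_product_alternate Lambda_mult Lambda_elementary S)
    also have "\<dots> = (\<Sum>I\<in>?\<I>. alternate n (vector_coeff S n) (\<lambda>i. a i - of_bool (i \<in> I)))"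
      unfolding alternate_def vector_coeff_elementary_mult sum_distrib_left
      by (subst sum.swap) (simp add: algebra_simps)
    also have "\<dots> = (\<Sum>I\<in>?\<I>. scalar_product (?R I) S)"
      by (simp add: scalar_product_alternate[OF S])
    also have "\<dots> = scalar_product (\<Sum>I\<in>?\<I>. ?R I) S"
      using S alt by (simp add: scalar_product_sum_left)
    also have "(-1) ^ j * \<dots> = scalar_product ((-1) ^ j * (\<Sum>I\<in>?\<I>. ?R I)) S"
      unfolding minus_one_power_mult_eq_scale
      using S alt by (simp add: scalar_product_commute[of _ S] scalar_product_scale_right Lambda_sum)
    finally show "scalar_product ((-1) ^ j * (\<Sum>I\<in>?\<I>. ?R I)) S
        = scalar_product ?Q (truncate D (?P * S))" ..
  qed
qed

text \<open>Lowering \<open>j\<close> rows in all possible ways amounts to lowering \<open>j\<close> columns in all possible ways, and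
  a choice of columns other than the first \<open>j\<close> creates two equal columns.\<close>

lemma sum_alternate_lowered:
  assumes j: "j \<le> n"
  shows "(\<Sum>I | I \<subseteq> {0..<n} \<and> card I = j.
      alternate n (complete_product n) (\<lambda>i. a i - of_bool (i \<in> I)))
    = det (mat n n (\<lambda>(i, c). complete_homogeneous (a i + int c - of_bool (c < j))))"
    (is "?L = det (?A {0..<j})")
proof -
  let ?\<I> = "{I. I \<subseteq> {0..<n} \<and> card I = j}"
  define A where "A J = mat n n (\<lambda>(i, c). complete_homogeneous (a i + int c - of_bool (c \<in> J)))" for J
  have det: "det (A J) = (\<Sum>w | w permutes {0..<n}. signof w *
      (\<Prod>i\<in>{0..<n}. complete_homogeneous (a i + int (w i) - of_bool (w i \<in> J))))" for J
    unfolding A_def by (subst det_def'[of _ n]) (auto intro!: sum.cong prod.cong)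
  have "?L = (\<Sum>w | w permutes {0..<n}. \<Sum>I\<in>?\<I>. signof w *
      (\<Prod>i\<in>{0..<n}. complete_homogeneous (a i + int (w i) - of_bool (i \<in> I))))"
    unfolding alternate_def complete_product_def
    by (subst sum.swap) (simp add: algebra_simps)
  also have "\<dots> = (\<Sum>w | w permutes {0..<n}. \<Sum>J\<in>?\<I>. signof w *
      (\<Prod>i\<in>{0..<n}. complete_homogeneous (a i + int (w i) - of_bool (w i \<in> J))))"
  proof (rule sum.cong[OF refl])
    fix w assume "w \<in> {w. w permutes {0..<n}}"
    then have w: "w permutes {0..<n}" by simp
    define v where "v = inv_into UNIV w"
    have v: "v permutes {0..<n}" unfolding v_def by (rule permutes_inv[OF w])
    have wv: "w (v x) = x" "v (w x) = x" for x
      unfolding v_def by (simp_all add: permutes_inverses[OF w])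
    have image: "u ` I \<in> ?\<I>" if "u permutes {0..<n}" "I \<in> ?\<I>" for u I
    proof -
      have "u ` I \<subseteq> u ` {0..<n}" using that(2) by (intro image_mono) simp
      then show ?thesis
        using that card_image[OF inj_on_subset[OF permutes_inj[OF that(1)] subset_UNIV], of I]
        by (simp add: permutes_image[OF that(1)])
    qed
    \<comment> \<open>Row \<open>i\<close> is matched with column \<open>w i\<close>, so lowering
      the rows in \<open>I\<close> has the same effect as lowering the columns in the image of
      \<open>I\<close> under \<open>w\<close>.\<close>
    show "(\<Sum>I\<in>?\<I>. signof w * (\<Prod>i\<in>{0..<n}. complete_homogeneous (a i + int (w i) - of_bool (i \<in> I))))
        = (\<Sum>J\<in>?\<I>. signof w * (\<Prod>i\<in>{0..<n}. complete_homogeneous (a i + int (w i) - of_bool (w i \<in> J))))"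
    proof (rule sum.reindex_bij_witness[of _ "image v" "image w"])
      fix I
      have "w i \<in> w ` I \<longleftrightarrow> i \<in> I" for i
        using permutes_inj[OF w] by (simp add: inj_image_mem_iff)
      then show "signof w * (\<Prod>i\<in>{0..<n}. complete_homogeneous (a i + int (w i) - of_bool (w i \<in> w ` I)))
          = signof w * (\<Prod>i\<in>{0..<n}. complete_homogeneous (a i + int (w i) - of_bool (i \<in> I)) :: nat series)"
        by (simp only:)
    qed (use image[OF w] image[OF v] wv in \<open>simp_all add: image_image\<close>)
  qed
  also have "\<dots> = (\<Sum>J\<in>?\<I>. det (A J))"
    unfolding det by (rule sum.swap)
  also have "\<dots> = (\<Sum>J\<in>?\<I>. if J = {0..<j} then det (A {0..<j}) else 0)"
  proof (rule sum.cong[OF refl])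
    fix J assume J: "J \<in> ?\<I>"
    show "det (A J) = (if J = {0..<j} then det (A {0..<j}) else 0)"
    proof (cases "\<exists>c. c \<notin> J \<and> Suc c \<in> J")
      case True
      then obtain c where c: "c \<notin> J" "Suc c \<in> J" by blast
      then have "Suc c < n" using J by auto
      \<comment> \<open>Lowering column \<open>c + 1\<close> but not column \<open>c\<close> makes
        both carry the offset \<open>c\<close>.\<close>
      then have "col (A J) c = col (A J) (Suc c)"
        using c by (intro eq_vecI) (auto simp: A_def)
      then have "det (A J) = 0"
        using \<open>Suc c < n\<close> by (intro det_identical_columns[of _ n c "Suc c"]) (auto simp: A_def)
      moreover have "J \<noteq> {0..<j}" using c by auto
      ultimately show ?thesis by simp
    next
      case False
      \<comment> \<open>Without such a gap \<open>J\<close> is closed downwards, hence an initial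
        segment, and its length is its cardinality \<open>j\<close>.\<close>
      have down: "c \<in> J" if "c + k \<in> J" for c k
        using that False by (induction k) auto
      have fin: "finite J" using J finite_subset by blast
      have "J = {0..<j}"
      proof (rule card_subset_eq[symmetric])
        show "card {0..<j} = card J" using J by simp
        show "{0..<j} \<subseteq> J"
        proof (rule ccontr)
          assume "\<not> {0..<j} \<subseteq> J"
          then obtain c where "c \<in> {0..<j}" and "c \<notin> J" by blast
          then have c: "c < j" "c \<notin> J" by simp_all
          have "J \<subseteq> {0..<c}"
          proof
            fix x assume "x \<in> J"
            then show "x \<in> {0..<c}" using down[of c "x - c"] c(2) by (cases "c \<le> x") auto
          qed
          then have "card J \<le> c" using card_mono[of "{0..<c}" J] by simp
          then show False using J c(1) by simp
        qed
      qed (rule fin)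
      then show ?thesis by simp
    qed
  qed
  also have "\<dots> = det (A {0..<j})"
  proof -
    have "finite ?\<I>" by (rule finite_subset[of _ "Pow {0..<n}"]) auto
    then show ?thesis using j by simp
  qed
  finally show ?thesis by (simp add: A_def)
qed

lemma schur_Cons:
  "schur (r # \<nu>) = (\<Sum>j\<le>length \<nu>. complete_homogeneous (r + int j)
      * skew (aux_coeff j (Omega (- auxX))) (schur \<nu>))"
proof -
  let ?n = "length \<nu>"
  let ?a = "\<lambda>i. padded \<nu> i - int i"
  define A where "A = mat (Suc ?n) (Suc ?n)
      (\<lambda>(i, j). complete_homogeneous ((r # \<nu>) ! i - int i + int j))"
  have A: "A \<in> carrier_mat (Suc ?n) (Suc ?n)" by (simp add: A_def)
  have "schur (r # \<nu>) = (\<Sum>j<Suc ?n. A $$ (0, j) * cofactor A 0 j)"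
    unfolding schur_def using laplace_expansion_row[OF A, of 0] by (simp add: A_def)
  also have "\<dots> = (\<Sum>j\<le>?n. complete_homogeneous (r + int j)
      * skew (aux_coeff j (Omega (- auxX))) (schur \<nu>))"
  proof (rule sum.cong)
    fix j assume "j \<in> {..?n}"
    then have j: "j \<le> ?n" by simp
    \<comment> \<open>Deleting row 0 lowers every offset by one; the columns after \<open>j\<close>
      move left and regain it, while those before \<open>j\<close> stay lowered.\<close>
    have "mat_delete A 0 j
        = mat ?n ?n (\<lambda>(i, c). complete_homogeneous (?a i + int c - of_bool (c < j)))"
      using j by (intro eq_matI) (auto simp: mat_delete_def A_def padded_def algebra_simps)
    then have "cofactor A 0 j = (-1) ^ j * (\<Sum>I | I \<subseteq> {0..<?n} \<and> card I = j.
        alternate ?n (complete_product ?n) (\<lambda>i. ?a i - of_bool (i \<in> I)))"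
      by (simp add: cofactor_def sum_alternate_lowered[OF j])
    also have "\<dots> = skew (aux_coeff j (Omega (- auxX))) (schur \<nu>)"
      by (simp add: aux_coeff_Omega_uminus_auxX schur_eq_alternate skew_elementary_alternate)
    finally show "A $$ (0, j) * cofactor A 0 j = complete_homogeneous (r + int j)
        * skew (aux_coeff j (Omega (- auxX))) (schur \<nu>)"
      using j by (simp add: A_def)
  qed auto
  finally show ?thesis .
qed

lemma skew_aux_coeff_schur_eq_0:
  assumes "length \<nu> < j"
  shows "skew (aux_coeff j (Omega (- auxX))) (schur \<nu>) = 0"
proof -
  have "{I. I \<subseteq> {0..<length \<nu>} \<and> card I = j} = {}"
  proof -
    have "card I \<le> length \<nu>" if "I \<subseteq> {0..<length \<nu>}" for I
      using card_mono[OF _ that] by simp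
    then show ?thesis using assms by (auto simp: not_le[symmetric])
  qed
  then show ?thesis
    by (simp only: aux_coeff_Omega_uminus_auxX schur_eq_alternate skew_elementary_alternate
        sum.empty mult_zero_right)
qed

text \<open>The condition \<open>i - j = r\<close> leaves one free index \<open>j\<close>. Terms
  with \<open>j\<close> above the number of rows vanish by skewing and those with
  \<open>r + j < 0\<close> have no power of \<open>z\<close>, which matches the vanishing entries in
  the Laplace expansion.\<close>

lemma bernstein_schur: "bernstein r (schur \<nu>) = schur (r # \<nu>)"
proof -
  let ?n = "length \<nu>"
  let ?s = "\<lambda>j. skew (aux_coeff j (Omega (- auxX))) (schur \<nu>)"
  let ?J = "{j. j \<le> ?n \<and> 0 \<le> r + int j}"
  let ?g = "\<lambda>(i, j). if int i - int j = r then aux_coeff i (Omega auxX) * ?s j else 0"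
  let ?p = "\<lambda>j. (nat (r + int j), j)"
  have inj: "inj_on ?p ?J" by (auto intro: inj_onI)
  have "bernstein r (schur \<nu>) = sum ?g (?p ` ?J)"
    unfolding bernstein_def
  proof (rule Sum_any.expand_superset)
    show "{q. ?g q \<noteq> 0} \<subseteq> ?p ` ?J"
    proof
      fix q assume q: "q \<in> {q. ?g q \<noteq> 0}"
      obtain i j where ij: "q = (i, j)" by fastforce
      have r: "int i - int j = r" and "?s j \<noteq> 0"
        using q by (auto simp: ij split: if_splits)
      then have "j \<le> ?n" using skew_aux_coeff_schur_eq_0[of \<nu> j] by (meson not_less)
      then show "q \<in> ?p ` ?J" using r by (intro image_eqI[of _ _ j]) (auto simp: ij)
    qed
  qed simp
  also have "\<dots> = (\<Sum>j\<in>?J. complete_homogeneous (r + int j) * ?s j)"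
    unfolding sum.reindex[OF inj] by (intro sum.cong) (auto simp: aux_coeff_Omega_auxX)
  also have "\<dots> = (\<Sum>j\<le>?n. complete_homogeneous (r + int j) * ?s j)"
  proof (rule sum.mono_neutral_left)
    show "\<forall>j\<in>{..?n} - ?J. complete_homogeneous (r + int j) * ?s j = 0"
    proof
      fix j assume "j \<in> {..?n} - ?J"
      then have "r + int j < 0" by auto
      then show "complete_homogeneous (r + int j) * ?s j = 0" by simp
    qed
  qed auto
  finally show ?thesis by (simp add: schur_Cons)
qed

lemma bernstein_list_one: "bernstein_list \<nu> 1 = schur \<nu>"
  by (induction \<nu>) (simp_all add: bernstein_list_def bernstein_schur)

lemma symmetric_f_diamond: "symmetric_series (f_diamond D)"
  by (cases D) (simp_all add: symmetric_add symmetric_Lambda[OF Lambda_schur])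

lemma scoeff_f_diamond_empty: "scoeff (f_diamond D) {#} = 0"
proof -
  have "scoeff (schur \<nu>) {#} = 0" if "sum_list \<nu> \<noteq> 0" for \<nu>
    using scoeff_schur_nonzero[of \<nu> "{#}"] that by auto
  then show ?thesis by (cases D) simp_all
qed

theorem mainTheorem1:
  fixes D :: diamond and n :: nat and \<nu> :: "int list"
  assumes "n \<ge> 1" and "length \<nu> = n"
  shows "foldr (\<lambda>r T. bernstein_diamond D [r] \<circ> T) \<nu> id 1 = bernstein_diamond D \<nu> 1
       \<and> bernstein_diamond D \<nu> 1 = schur_diamond D \<nu>"
proof -
  let ?f = "f_diamond D"
  have sym: "symmetric_series (Omega ?f)" "symmetric_series (Omega (- ?f))"
    by (simp_all add: symmetric_Omega symmetric_uminus symmetric_f_diamond)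
  \<comment> \<open>Both skewings fix \<open>1\<close>, so conjugation by them disturbs neither the
    vector on which the operators act nor the value for the empty list.\<close>
  have one: "skew (Omega ?f) 1 = 1" "skew (Omega (- ?f)) 1 = 1"
    by (simp_all add: skew_one sym scoeff_Omega_empty scoeff_f_diamond_empty)
  have "Omega ?f * Omega (- ?f) = 1"
    using Omega_uminus_mult[OF scoeff_f_diamond_empty, of D] by (simp add: mult.commute)
  then have inv: "skew (Omega ?f) (skew (Omega (- ?f)) (schur \<kappa>)) = schur \<kappa>" for \<kappa>
    by (rule skew_skew_inverse[OF sym _ Lambda_schur])
  have "foldr (\<lambda>r T. bernstein_diamond D [r] \<circ> T) \<kappa> id 1 = schur_diamond D \<kappa>" for \<kappa>
  proof (induction \<kappa>)
    case Nil
    then show ?case by (simp add: schur_diamond_def one)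
  next
    case (Cons r \<kappa>)
    then show ?case
      by (simp add: bernstein_diamond_def bernstein_list_def schur_diamond_def inv bernstein_schur)
  qed
  moreover have "bernstein_diamond D \<nu> 1 = schur_diamond D \<nu>"
    by (simp add: bernstein_diamond_def schur_diamond_def one bernstein_list_one)
  ultimately show ?thesis by simp
qed

end
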